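(* Let $\mu$ be a symmetric (around $0$) unimodal probability distribution on $\mathbb{R}$. Then $\mu\boxplus S(0,t)$ is unimodal for any $t>0$.
   Context: Unimodality: a Borel measure $\mu$ on $\mathbb{R}$ is unimodal if there exist $a\in\mathbb{R}$ and a function $f\colon\mathbb{R}\to[0,\infty)$, non-decreasing on $(-\infty,a)$ and non-increasing on $(a,\infty)$, such that $\mu(dx)=\mu(\{a\})\delta_a+f(x)\,dx$. Semicircle distribution: for $t>0$, $S(0,t)$ is the probability measure with density $\frac{1}{2\pi t}\sqrt{4t-x^2}$ on its support $[-2\sqrt t,2\sqrt t]$. Free convolution $\boxplus$: let $\mathbb{C}^{\pm}$ be the open upper/lower half-planes. For a probability measure $\mu$ on $\mathbb{R}$ let $G_\mu(z)=\int_{\mathbb{R}}\frac{1}{z-x}\,d\mu(x)$, $z\in\mathbb{C}^+$, be its Cauchy transform. For every $\gamma>0$ there exist $\alpha,\beta,\delta>0$ such that $G_\mu$ is univalent on $\{z\in\mathbb{C}^+: |\mathrm{Re}\,z|<\alpha\,\mathrm{Im}\,z,\ \mathrm{Im}\,z>\beta\}$ and the image of this set under $G_\mu$ contains $\{z\in\mathbb{C}^-: |\mathrm{Re}\,z|<\gamma|\mathrm{Im}\,z|,\ |z|<\delta\}$; on the latter set one has the right inverse $G_\mu^{-1}$ and defines the R-transform $R_\mu(z)=G_\mu^{-1}(z)-\frac1z$. For probability measures $\mu,\nu$ on $\mathbb{R}$, $\mu\boxplus\nu$ is the unique probability measure $\lambda$ on $\mathbb{R}$ with $R_\lambda(z)=R_\mu(z)+R_\nu(z)$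 on the intersection of the domains of the three transforms. *)

theory Defs
  imports "HOL-Probability.Probability"
begin

definition unimodal :: "real measure \<Rightarrow> bool" where
  "unimodal \<mu> \<longleftrightarrow> sets \<mu> = sets borel \<and>
     (\<exists>a f. (\<forall>x. 0 \<le> f x) \<and> mono_on {..<a} f \<and> antimono_on {a<..} f \<and>
        (\<forall>A \<in> sets borel. emeasure \<mu> A =
           emeasure \<mu> {a} * indicator A a + (\<integral>\<^sup>+x\<in>A. ennreal (f x) \<partial>lborel)))"

definition symmetric_measure :: "real measure \<Rightarrow> bool" where
  "symmetric_measure \<mu> \<longleftrightarrow> distr \<mu> borel uminus = \<mu>"

definition semicircle :: "real \<Rightarrow> real measure" where
  "semicircle t = density lborel (\<lambda>x. ennreal
     (indicator {-2 * sqrt t .. 2 * sqrt t} x * (sqrt (4 * t - x\<^sup>2) / (2 * pi * t))))"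

definition cauchy_transform :: "real measure \<Rightarrow> complex \<Rightarrow> complex" where
  "cauchy_transform \<mu> z = (\<integral>x. 1 / (z - of_real x) \<partial>\<mu>)"

definition upper_cone :: "real \<Rightarrow> real \<Rightarrow> complex set" where
  "upper_cone \<alpha> \<beta> = {z. 0 < Im z \<and> \<bar>Re z\<bar> < \<alpha> * Im z \<and> \<beta> < Im z}"

definition lower_cone :: "real \<Rightarrow> real \<Rightarrow> complex set" where
  "lower_cone \<gamma> \<delta> = {z. Im z < 0 \<and> \<bar>Re z\<bar> < \<gamma> * \<bar>Im z\<bar> \<and> norm z < \<delta>}"

definition inversion_params :: "real measure \<Rightarrow> real \<Rightarrow> real \<Rightarrow> real \<Rightarrow> real \<Rightarrow> bool" where
  "inversion_params \<mu> \<gamma> \<alpha> \<beta> \<delta> \<longleftrightarrow> 0 < \<gamma> \<and> 0 < \<alpha> \<and> 0 < \<beta> \<and> 0 < \<delta> \<and>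
     inj_on (cauchy_transform \<mu>) (upper_cone \<alpha> \<beta>) \<and>
     lower_cone \<gamma> \<delta> \<subseteq> cauchy_transform \<mu> ` upper_cone \<alpha> \<beta>"

text \<open>
  The inverses obtained from different admissible parameters agree wherever both are
  defined: they agree near \<open>0\<close>, hence, by the identity theorem, on the (connected)
  intersection of two lower cones.  They are therefore glued to one inverse on the union of
  all admissible lower cones, which serves as the domain of the R-transform.
\<close>

definition R_domain :: "real measure \<Rightarrow> complex set" where
  "R_domain \<mu> = {z. \<exists>\<gamma> \<alpha> \<beta> \<delta>. inversion_params \<mu> \<gamma> \<alpha> \<beta> \<delta> \<and> z \<in> lower_cone \<gamma> \<delta>}"

definition cauchy_inverse :: "real measure \<Rightarrow> complex \<Rightarrow> complex" where
  "cauchy_inverse \<mu> z = (THE w. \<exists>\<gamma> \<alpha> \<beta> \<delta>. inversion_params \<mu> \<gamma> \<alpha> \<beta> \<delta> \<and>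
     z \<in> lower_cone \<gamma> \<delta> \<and> w \<in> upper_cone \<alpha> \<beta> \<and> cauchy_transform \<mu> w = z)"

definition R_transform :: "real measure \<Rightarrow> complex \<Rightarrow> complex" where
  "R_transform \<mu> z = cauchy_inverse \<mu> z - 1 / z"

definition free_convolution :: "real measure \<Rightarrow> real measure \<Rightarrow> real measure"
    (infixl \<open>\<boxplus>\<close> 65) where
  "\<mu> \<boxplus> \<nu> = (THE \<rho>. real_distribution \<rho> \<and>
     (\<forall>z \<in> R_domain \<mu> \<inter> R_domain \<nu> \<inter> R_domain \<rho>.
        R_transform \<rho> z = R_transform \<mu> z + R_transform \<nu> z))"

end

(*
  A probability measure \<rho> whose Cauchy transform satisfies G_\<rho> z = G_\<mu> (z - t G_\<rho> z) has
  R-transform R_\<mu> z + t z, so it is \<mu> \<boxplus> S(0,t). To find it, note that H w = w + t G_\<mu> w maps the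
  domain {w. t \<integral> 1 / |w - x|^2 d\<mu> x < 1} of the upper half-plane conformally onto the half-plane;
  its inverse F gives the bounded function (z - F z) / t, which by the Poisson formula is the
  Cauchy transform of the measure whose density is the limit of Im F (x + i \<epsilon>) / (\<pi> t). The
  semicircle law itself is the case where \<mu> is the unit mass at 0.

  Write F (x + i \<epsilon>) = u + i v. Then u is strictly increasing in x, and v is determined by
  v (1 - t J(u, v)) = \<epsilon> with J(u, v) = \<integral> 1 / |u + i v - x|^2 d\<mu> x. For symmetric unimodal \<mu>, J
  decreases in |u|, since it is up to a factor the convolution of \<mu> with a Cauchy law; hence v
  decreases in |x|, and Helly selection carries this over to the limit \<epsilon> \<rightarrow> 0.
*)

theory Submission
  imports Defs "HOL-Complex_Analysis.Complex_Analysis"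
begin

section \<open>Cauchy transforms\<close>

text \<open>The function \<open>(z - F z) / t\<close> is bounded because Cauchy-Schwarz gives
  \<open>|G|^2 \<le> J\<close>, and \<open>J < 1 / t\<close> holds on the domain of
  \<open>H\<close>. This is why the limit measure has a density and no singular part. The same
  inequality \<open>J < 1 / t\<close>, used at two points at once, makes \<open>H\<close> injective
  and \<open>Re F\<close> increasing. Monotonicity is proved at positive height \<epsilon> because
  on the real line the equation for \<open>v\<close> degenerates to \<open>v (1 - t J) = 0\<close>,
  which no longer determines \<open>v\<close>. Bounded monotone functions converge along a
  subsequence off a countable set, and a density matters only almost everywhere, so no finer
  boundary behaviour of \<open>F\<close> enters. Both \<boxplus> and the inverse of \<open>G\<close>
  are definite descriptions, so each calls for a uniqueness result: inverses coming from different
  cones are reconciled by the identity theorem, and a measure is recovered from its R-transform on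
  an arbitrarily small cone by way of its Cauchy transform. Hence R-transforms are only ever
  computed near 0.\<close>

abbreviation upper_half_plane :: "complex set" where
  "upper_half_plane \<equiv> {z. 0 < Im z}"

lemma open_upper_half_plane: "open upper_half_plane"
  by (simp add: open_halfspace_Im_gt)

lemma connected_upper_half_plane: "connected upper_half_plane"
  by (simp add: convex_connected convex_halfspace_Im_gt)

lemma Im_le_norm_diff_of_real: "\<bar>Im z\<bar> \<le> norm (z - of_real x)"
  by (metis abs_Im_le_cmod Im_complex_of_real diff_zero minus_complex.simps(2))

lemma neq_of_real: "0 < Im z \<Longrightarrow> z \<noteq> of_real x"
  by auto

context real_distribution
begin

text \<open>This is \<open>J\<close> of the overview. It serves in three ways: it equals
  \<open>- Im G / Im z\<close>, it bounds \<open>|G|^2\<close>, and it bounds the difference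
  quotients of \<open>G\<close>.\<close>

definition resolvent_energy :: "complex \<Rightarrow> real" where
  "resolvent_energy z = (\<integral>x. 1 / (norm (z - of_real x))\<^sup>2 \<partial>M)"

lemma norm_resolvent_le: "0 < Im z \<Longrightarrow> norm (1 / (z - of_real x)) \<le> 1 / Im z"
  using Im_le_norm_diff_of_real[of z x] by (auto simp: norm_divide intro!: divide_left_mono mult_pos_pos)

lemma integrable_resolvent: "0 < Im z \<Longrightarrow> integrable M (\<lambda>x. 1 / (z - of_real x))"
  by (rule integrable_const_bound[where B="1 / Im z"]) (use norm_resolvent_le in auto)

lemma norm_resolvent_mult_le:
  assumes "0 < Im z" "0 < Im w"
  shows "norm (1 / ((z - of_real x) * (w - of_real x))) \<le> 1 / (Im z * Im w)"
proof -
  have "norm (1 / (z - of_real x)) * norm (1 / (w - of_real x)) \<le> (1 / Im z) * (1 / Im w)"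
    using assms by (intro mult_mono norm_resolvent_le) auto
  then show ?thesis by (simp add: norm_mult norm_divide)
qed

lemma integrable_resolvent_mult:
  "0 < Im z \<Longrightarrow> 0 < Im w \<Longrightarrow> integrable M (\<lambda>x. 1 / ((z - of_real x) * (w - of_real x)))"
  by (rule integrable_const_bound[where B="1 / (Im z * Im w)"]) (use norm_resolvent_mult_le in auto)

lemma integrable_resolvent_norm:
  assumes "0 < Im z"
  shows "integrable M (\<lambda>x. 1 / (norm (z - of_real x))\<^sup>2)"
  using integrable_norm[OF integrable_resolvent_mult[OF assms assms]]
  by (simp add: norm_divide norm_mult power2_eq_square)

text \<open>The resolvent identity under the integral. Up to sign, the integral on the right is a
  difference quotient of \<open>G\<close>; the derivative of \<open>G\<close>, its injectivity in
  cones and the injectivity of \<open>H\<close> all start from it.\<close>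

lemma cauchy_transform_diff:
  assumes "0 < Im z" "0 < Im w"
  shows "cauchy_transform M z - cauchy_transform M w =
    (w - z) * (\<integral>x. 1 / ((z - of_real x) * (w - of_real x)) \<partial>M)"
proof -
  have "cauchy_transform M z - cauchy_transform M w = (\<integral>x. 1 / (z - of_real x) - 1 / (w - of_real x) \<partial>M)"
    unfolding cauchy_transform_def using assms by (simp add: integrable_resolvent)
  also have "\<dots> = (\<integral>x. (w - z) * (1 / ((z - of_real x) * (w - of_real x))) \<partial>M)"
    using assms by (intro Bochner_Integration.integral_cong) (auto simp: field_simps neq_of_real)
  finally show ?thesis by (simp only: integral_mult_right_zero)
qed

text \<open>The arithmetic-geometric mean inequality under the integral. The bound is linear in the
  energies: if both lie below \<open>1 / t\<close>, so does their mean.\<close>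

lemma norm_integral_resolvent_mult_le:
  assumes "0 < Im z" "0 < Im w"
  shows "norm (\<integral>x. 1 / ((z - of_real x) * (w - of_real x)) \<partial>M)
    \<le> (resolvent_energy z + resolvent_energy w) / 2"
proof -
  have "norm (\<integral>x. 1 / ((z - of_real x) * (w - of_real x)) \<partial>M)
    \<le> (\<integral>x. (1 / (norm (z - of_real x))\<^sup>2 + 1 / (norm (w - of_real x))\<^sup>2) / 2 \<partial>M)"
  proof (rule Bochner_Integration.integral_norm_bound_integral)
    fix x
    have "2 * (1 / norm (z - of_real x)) * (1 / norm (w - of_real x)) \<le>
      (1 / norm (z - of_real x))\<^sup>2 + (1 / norm (w - of_real x))\<^sup>2"
      by (rule sum_squares_bound)
    then show "norm (1 / ((z - of_real x) * (w - of_real x)))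
      \<le> (1 / (norm (z - of_real x))\<^sup>2 + 1 / (norm (w - of_real x))\<^sup>2) / 2"
      by (simp add: norm_mult norm_divide power_divide)
  qed (use assms in \<open>auto intro!: integrable_resolvent_mult integrable_resolvent_norm\<close>)
  also have "\<dots> = (resolvent_energy z + resolvent_energy w) / 2"
    unfolding resolvent_energy_def using assms by (simp add: integrable_resolvent_norm)
  finally show ?thesis .
qed

lemma Im_cauchy_transform:
  assumes "0 < Im z"
  shows "Im (cauchy_transform M z) = - Im z * resolvent_energy z"
proof -
  have "Im (cauchy_transform M z) = (\<integral>x. Im (1 / (z - of_real x)) \<partial>M)"
    unfolding cauchy_transform_def using assms by (intro integral_Im[symmetric] integrable_resolvent)
  also have "\<dots> = (\<integral>x. - Im z * (1 / (norm (z - of_real x))\<^sup>2) \<partial>M)"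
    by (intro Bochner_Integration.integral_cong) (auto simp: Im_divide cmod_power2)
  finally show ?thesis
    unfolding resolvent_energy_def by (subst (asm) integral_mult_right_zero)
qed

lemma resolvent_energy_pos:
  assumes "0 < Im z"
  shows "0 < resolvent_energy z"
proof -
  have "0 \<le> resolvent_energy z"
    unfolding resolvent_energy_def by (intro integral_nonneg_AE) auto
  moreover have "resolvent_energy z \<noteq> 0"
  proof
    assume "resolvent_energy z = 0"
    then have "AE x in M. 1 / (norm (z - of_real x))\<^sup>2 = 0"
      unfolding resolvent_energy_def
      using assms by (subst (asm) integral_nonneg_eq_0_iff_AE) (auto intro: integrable_resolvent_norm)
    then have "AE x in M. False"
      by eventually_elim (use assms in auto)
    then show False by simp
  qed
  ultimately show ?thesis by simp
qed

lemma resolvent_energy_antimono: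
  assumes "0 < v" "v \<le> v'"
  shows "resolvent_energy (Complex u v') \<le> resolvent_energy (Complex u v)"
  unfolding resolvent_energy_def
proof (rule integral_mono)
  fix x
  show "1 / (norm (Complex u v' - of_real x))\<^sup>2 \<le> 1 / (norm (Complex u v - of_real x))\<^sup>2"
    using assms by (intro divide_left_mono) (auto simp: cmod_power2 power_mono add_nonneg_pos)
qed (use assms in \<open>auto intro!: integrable_resolvent_norm\<close>)

text \<open>Cauchy-Schwarz for a probability measure, in the form that a variance is
  nonnegative.\<close>

lemma norm_cauchy_transform_le_energy:
  assumes "0 < Im z"
  shows "(norm (cauchy_transform M z))\<^sup>2 \<le> resolvent_energy z"
proof -
  let ?f = "\<lambda>x. 1 / norm (z - of_real x)"
  have i1: "integrable M ?f"
    using integrable_norm[OF integrable_resolvent[OF assms]] by (simp add: norm_divide)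
  have i2: "integrable M (\<lambda>x. (?f x)\<^sup>2)"
    using integrable_resolvent_norm[OF assms] by (simp add: power_divide)
  have "norm (cauchy_transform M z) \<le> (\<integral>x. ?f x \<partial>M)"
    unfolding cauchy_transform_def using integral_norm_bound[of M "\<lambda>x. 1 / (z - of_real x)"]
    by (simp add: norm_divide)
  then have "(norm (cauchy_transform M z))\<^sup>2 \<le> (\<integral>x. ?f x \<partial>M)\<^sup>2"
    by (intro power_mono) auto
  also have "\<dots> \<le> (\<integral>x. (?f x)\<^sup>2 \<partial>M)"
    using variance_positive[of ?f] variance_eq[OF i1 i2] by linarith
  finally show ?thesis
    by (simp add: resolvent_energy_def power_divide)
qed

lemma norm_cauchy_transform_le:
  assumes "0 < Im z"
  shows "norm (cauchy_transform M z) \<le> 1 / Im z"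
proof -
  have "norm (cauchy_transform M z) \<le> (\<integral>x. 1 / Im z \<partial>M)"
    unfolding cauchy_transform_def
    using assms by (intro Bochner_Integration.integral_norm_bound_integral integrable_resolvent norm_resolvent_le) auto
  then show ?thesis by (simp add: prob_space[simplified])
qed

lemma cauchy_transform_has_field_derivative:
  assumes z: "0 < Im z"
  shows "(cauchy_transform M has_field_derivative - (\<integral>x. 1 / ((z - of_real x) * (z - of_real x)) \<partial>M)) (at z)"
proof -
  let ?D = "\<lambda>w. \<integral>x. 1 / ((w - of_real x) * (z - of_real x)) \<partial>M"
  \<comment> \<open>Keeping \<open>Im w\<close> above half of \<open>Im z\<close> turns the factor
    \<open>1 / Im w\<close> into the 2 of the constant \<open>2 / (Im z)^3\<close> below.\<close>
  have ev: "\<forall>\<^sub>F w in at z. Im z / 2 < Im w"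
  proof -
    have "open {w. Im z / 2 < Im w}" by (rule open_halfspace_Im_gt)
    then show ?thesis using z by (auto simp: eventually_at_topological intro!: exI[of _ "{w. Im z / 2 < Im w}"])
  qed
  have "(?D \<longlongrightarrow> ?D z) (at z)"
  proof (rule Lim_transform_bound[of "\<lambda>w. ?D w - ?D z", THEN LIM_zero_cancel])
    show "\<forall>\<^sub>F w in at z. norm (?D w - ?D z) \<le> norm ((w - z) * of_real (2 / (Im z)^3))"
      using ev
    proof eventually_elim
      case (elim w)
      then have w: "0 < Im w" using z by linarith
      have "?D w - ?D z = (\<integral>x. 1 / ((w - of_real x) * (z - of_real x)) - 1 / ((z - of_real x) * (z - of_real x)) \<partial>M)"
        using z w by (intro Bochner_Integration.integral_diff[symmetric] integrable_resolvent_mult) auto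
      also have "norm \<dots> \<le> (\<integral>x. norm (w - z) * (2 / (Im z)^3) \<partial>M)"
      proof (rule Bochner_Integration.integral_norm_bound_integral)
        fix x
        have "1 / ((w - of_real x) * (z - of_real x)) - 1 / ((z - of_real x) * (z - of_real x))
          = (z - w) * ((1 / ((w - of_real x) * (z - of_real x))) * (1 / (z - of_real x)))"
        proof -
          have "1 / (a * b) - 1 / (b * b) = (b - a) * ((1 / (a * b)) * (1 / b))"
            if "a \<noteq> 0" "b \<noteq> 0" for a b :: complex
            using that by (simp add: field_simps)
          from this[of "w - of_real x" "z - of_real x"] z w show ?thesis
            by (auto simp: neq_of_real)
        qed
        moreover have "norm (1 / ((w - of_real x) * (z - of_real x))) * norm (1 / (z - of_real x))
          \<le> (1 / (Im w * Im z)) * (1 / Im z)"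
          using z w by (intro mult_mono norm_resolvent_mult_le norm_resolvent_le) auto
        moreover have "(1 / (Im w * Im z)) * (1 / Im z) \<le> 2 / (Im z)^3"
        proof -
          have "(1 / (Im w * Im z)) * (1 / Im z) = 1 / (Im w * (Im z)\<^sup>2)"
            by (simp add: power2_eq_square)
          also have "\<dots> \<le> 1 / (Im z / 2 * (Im z)\<^sup>2)"
            using elim z w by (intro divide_left_mono mult_right_mono mult_pos_pos) auto
          finally show ?thesis by (simp add: power3_eq_cube power2_eq_square mult.assoc)
        qed
        ultimately have le: "norm (1 / ((w - of_real x) * (z - of_real x))) * norm (1 / (z - of_real x)) \<le> 2 / (Im z)^3"
          and eq: "1 / ((w - of_real x) * (z - of_real x)) - 1 / ((z - of_real x) * (z - of_real x))
          = (z - w) * ((1 / ((w - of_real x) * (z - of_real x))) * (1 / (z - of_real x)))"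
          by auto
        show "norm (1 / ((w - of_real x) * (z - of_real x)) - 1 / ((z - of_real x) * (z - of_real x)))
          \<le> norm (w - z) * (2 / (Im z)^3)"
          unfolding eq using mult_left_mono[OF le, of "norm (w - z)"]
          by (simp only: norm_mult norm_minus_commute[of z w]) simp
      qed (use z w in \<open>auto intro!: integrable_resolvent_mult\<close>)
      finally show ?case
        unfolding norm_mult norm_of_real using z by (simp add: prob_space[simplified])
    qed
    have "((\<lambda>w. (w - z) * of_real (2 / (Im z)^3)) \<longlongrightarrow> (z - z) * of_real (2 / (Im z)^3)) (at z)"
      by (intro tendsto_intros)
    then show "((\<lambda>w. (w - z) * of_real (2 / (Im z)^3)) \<longlongrightarrow> 0) (at z)"
      by simp
  qed
  then have "((\<lambda>w. - ?D w) \<longlongrightarrow> - ?D z) (at z)"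
    by (rule tendsto_minus)
  then show ?thesis
    unfolding has_field_derivative_iff
  proof (rule Lim_transform_eventually)
    have "\<forall>\<^sub>F w in at z. w \<noteq> z" by (simp add: eventually_at_filter)
    then show "\<forall>\<^sub>F w in at z. - ?D w = (cauchy_transform M w - cauchy_transform M z) / (w - z)"
      using ev
    proof eventually_elim
      case (elim w)
      then have "0 < Im w" using z by linarith
      from cauchy_transform_diff[OF this z] elim show ?case
        by (simp add: field_simps)
    qed
  qed
qed

lemma holomorphic_cauchy_transform: "cauchy_transform M holomorphic_on upper_half_plane"
  using cauchy_transform_has_field_derivative
  by (subst holomorphic_on_open[OF open_upper_half_plane]) auto

lemma continuous_on_cauchy_transform: "continuous_on upper_half_plane (cauchy_transform M)"
  by (rule holomorphic_on_imp_continuous_on[OF holomorphic_cauchy_transform])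

end

section \<open>Inversion in cones and the R-transform\<close>

lemma lower_cone_conv_halfspaces:
  "lower_cone \<gamma> \<delta> = {z. inner (Complex 0 1) z < 0} \<inter> {z. inner (Complex 1 \<gamma>) z < 0}
    \<inter> {z. inner (Complex (-1) \<gamma>) z < 0} \<inter> ball 0 \<delta>"
  by (auto simp: lower_cone_def inner_complex_def)

lemma open_lower_cone: "open (lower_cone \<gamma> \<delta>)"
  unfolding lower_cone_conv_halfspaces
  by (intro open_Int open_halfspace_lt open_ball)

lemma connected_lower_cone: "connected (lower_cone \<gamma> \<delta>)"
  unfolding lower_cone_conv_halfspaces
  by (intro convex_connected convex_Int convex_halfspace_lt convex_ball)

text \<open>Lower cones are closed under intersection, hence the common domains of several inverses
  are connected and the identity theorem applies there.\<close>

lemma lower_cone_Int: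
  "lower_cone \<gamma> \<delta> \<inter> lower_cone \<gamma>' \<delta>' = lower_cone (min \<gamma> \<gamma>') (min \<delta> \<delta>')"
  by (auto simp: lower_cone_def min_mult_distrib_right)

lemma lower_cone_mono: "\<gamma> \<le> \<gamma>' \<Longrightarrow> \<delta> \<le> \<delta>' \<Longrightarrow> lower_cone \<gamma> \<delta> \<subseteq> lower_cone \<gamma>' \<delta>'"
  by (auto simp: lower_cone_def intro: less_le_trans mult_right_mono)

lemma lower_cone_nonempty:
  assumes "0 < \<gamma>" "0 < \<delta>"
  shows "lower_cone \<gamma> \<delta> \<noteq> {}"
proof -
  have "- \<i> * of_real (\<delta> / 2) \<in> lower_cone \<gamma> \<delta>"
    using assms by (auto simp: lower_cone_def norm_mult)
  then show ?thesis by blast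
qed

lemma upper_cone_subset: "upper_cone \<alpha> \<beta> \<subseteq> upper_half_plane"
  by (auto simp: upper_cone_def)

lemma upper_coneD: "z \<in> upper_cone \<alpha> \<beta> \<Longrightarrow> 0 < Im z \<and> \<bar>Re z\<bar> < \<alpha> * Im z \<and> \<beta> < Im z"
  by (simp add: upper_cone_def)

lemma open_upper_cone: "open (upper_cone \<alpha> \<beta>)"
proof -
  have "upper_cone \<alpha> \<beta> = {z. Im z > 0} \<inter> {z. inner (Complex 1 (-\<alpha>)) z < 0}
    \<inter> {z. inner (Complex (-1) (-\<alpha>)) z < 0} \<inter> {z. Im z > \<beta>}"
    by (auto simp: upper_cone_def inner_complex_def)
  then show ?thesis
    by (simp only:) (intro open_Int open_halfspace_lt open_halfspace_Im_gt)
qed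

lemma inversion_paramsD:
  assumes "inversion_params \<mu> \<gamma> \<alpha> \<beta> \<delta>"
  shows "0 < \<gamma>" "0 < \<alpha>" "0 < \<beta>" "0 < \<delta>" "inj_on (cauchy_transform \<mu>) (upper_cone \<alpha> \<beta>)"
    "lower_cone \<gamma> \<delta> \<subseteq> cauchy_transform \<mu> ` upper_cone \<alpha> \<beta>"
  using assms by (auto simp: inversion_params_def)

section \<open>Asymptotics of the Cauchy transform in a cone and existence of inverses\<close>

context real_distribution
begin

text \<open>The integrand dominates \<open>|x / (z - x)|\<close> for all \<open>z\<close> in the
  cone: \<open>\<alpha> + 2\<close> comes from \<open>|x| \<le> |z| + |z - x|\<close> and
  \<open>|z| \<le> (\<alpha> + 1) * Im z\<close>, while \<open>\<bar>x\<bar> / \<beta>\<close> comes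
  from \<open>|z - x| \<ge> Im z > \<beta>\<close>. The truncation keeps it integrable for measures
  without moments.\<close>

definition cone_defect :: "real \<Rightarrow> real \<Rightarrow> real" where
  "cone_defect \<alpha> \<beta> = (\<integral>x. min (\<alpha> + 2) (\<bar>x\<bar> / \<beta>) \<partial>M)"

lemma cone_defect_integrable:
  "0 < \<alpha> \<Longrightarrow> 0 < \<beta> \<Longrightarrow> integrable M (\<lambda>x. min (\<alpha> + 2) (\<bar>x\<bar> / \<beta>))"
  by (rule integrable_const_bound[where B="\<alpha> + 2"]) (auto simp: min_def)

lemma cone_defect_small:
  assumes \<alpha>: "0 < \<alpha>" and \<epsilon>: "0 < \<epsilon>"
  obtains \<beta> where "B \<le> \<beta>" "0 < \<beta>" "cone_defect \<alpha> \<beta> < \<epsilon>"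
proof -
  have "(\<lambda>n. \<integral>x. min (\<alpha> + 2) (\<bar>x\<bar> / real (Suc n)) \<partial>M) \<longlonglongrightarrow> (\<integral>x. 0 \<partial>M)"
  proof (rule integral_dominated_convergence[where w="\<lambda>_. \<alpha> + 2"])
    show "AE x in M. (\<lambda>n. min (\<alpha> + 2) (\<bar>x\<bar> / real (Suc n))) \<longlonglongrightarrow> 0"
    proof (rule AE_I2)
      fix x :: real
      have "(\<lambda>n. \<bar>x\<bar> / real (Suc n)) \<longlonglongrightarrow> 0"
        using LIMSEQ_Suc[OF lim_const_over_n[of "\<bar>x\<bar>"]] by simp
      then have "(\<lambda>n. min (\<alpha> + 2) (\<bar>x\<bar> / real (Suc n))) \<longlonglongrightarrow> min (\<alpha> + 2) 0"
        by (intro tendsto_min tendsto_const)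
      then show "(\<lambda>n. min (\<alpha> + 2) (\<bar>x\<bar> / real (Suc n))) \<longlonglongrightarrow> 0"
        using \<alpha> by simp
    qed
  qed (use \<alpha> in \<open>auto simp: min_def\<close>)
  then have "(\<lambda>n. cone_defect \<alpha> (real (Suc n))) \<longlonglongrightarrow> 0"
    by (simp add: cone_defect_def)
  then have "\<forall>\<^sub>F n in sequentially. cone_defect \<alpha> (real (Suc n)) < \<epsilon>"
    using \<epsilon> by (rule order_tendstoD)
  moreover have "\<forall>\<^sub>F n in sequentially. B \<le> real (Suc n)"
    using eventually_ge_at_top[of "nat \<lceil>B\<rceil>"] by eventually_elim linarith
  ultimately have "\<forall>\<^sub>F n in sequentially. cone_defect \<alpha> (real (Suc n)) < \<epsilon> \<and> B \<le> real (Suc n)"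
    by eventually_elim simp
  then obtain n where "cone_defect \<alpha> (real (Suc n)) < \<epsilon> \<and> B \<le> real (Suc n)"
    by (auto simp: eventually_sequentially)
  then show thesis by (intro that[of "real (Suc n)"]) auto
qed

lemma upper_cone_resolvent_bound:
  assumes z: "z \<in> upper_cone \<alpha> \<beta>" and "0 < \<beta>"
  shows "norm (of_real x / (z - of_real x)) \<le> min (\<alpha> + 2) (\<bar>x\<bar> / \<beta>)"
proof -
  note z = upper_coneD[OF z]
  define d where "d = norm (z - of_real x)"
  have d: "Im z \<le> d" "0 < d"
    using Im_le_norm_diff_of_real[of z x] z by (auto simp: d_def)
  have "norm z \<le> \<bar>Re z\<bar> + \<bar>Im z\<bar>" by (rule cmod_le)
  also have "\<dots> \<le> (\<alpha> + 1) * Im z" using z by (simp add: algebra_simps)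
  finally have "norm z \<le> (\<alpha> + 1) * Im z" .
  moreover have "0 \<le> \<alpha>"
    by (rule ccontr) (use z mult_neg_pos[of \<alpha> "Im z"] in auto)
  then have "(\<alpha> + 1) * Im z \<le> (\<alpha> + 1) * d"
    using d by (intro mult_left_mono) auto
  moreover have "\<bar>x\<bar> \<le> norm z + d"
    unfolding d_def by (metis norm_of_real norm_triangle_sub norm_minus_commute real_norm_def)
  ultimately have "\<bar>x\<bar> \<le> (\<alpha> + 2) * d" by (simp add: algebra_simps)
  then have "\<bar>x\<bar> / d \<le> \<alpha> + 2" using d by (simp add: field_simps)
  moreover have "\<bar>x\<bar> / d \<le> \<bar>x\<bar> / \<beta>"
    using d z assms by (intro divide_left_mono) auto
  ultimately show ?thesis by (simp add: norm_divide d_def)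
qed

text \<open>Rests on \<open>z / (z - x) - 1 = x / (z - x)\<close>. Together with
  \<open>cone_defect_small\<close> this says that \<open>z * G z\<close> tends to 1 uniformly in the
  cone as \<beta> grows.\<close>

lemma cauchy_transform_asymp:
  assumes z: "z \<in> upper_cone \<alpha> \<beta>" and pos: "0 < \<alpha>" "0 < \<beta>"
  shows "norm (z * cauchy_transform M z - 1) \<le> cone_defect \<alpha> \<beta>"
proof -
  have Im: "0 < Im z" using upper_coneD[OF z] by simp
  have "z * cauchy_transform M z - 1 = (\<integral>x. z * (1 / (z - of_real x)) - 1 \<partial>M)"
  proof -
    have "integrable M (\<lambda>x. z * (1 / (z - of_real x)))"
      by (intro integrable_mult_right integrable_resolvent Im)
    from Bochner_Integration.integral_diff[OF this integrable_const[of 1]] show ?thesis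
      unfolding cauchy_transform_def
      by (simp only: integral_mult_right_zero) (simp add: prob_space[simplified])
  qed
  also have "norm \<dots> \<le> cone_defect \<alpha> \<beta>"
    unfolding cone_defect_def
  proof (rule Bochner_Integration.integral_norm_bound_integral)
    fix x
    have "z * (1 / (z - of_real x)) - 1 = of_real x / (z - of_real x)"
      using neq_of_real[OF Im, of x] by (simp add: field_simps)
    then show "norm (z * (1 / (z - of_real x)) - 1) \<le> min (\<alpha> + 2) (\<bar>x\<bar> / \<beta>)"
      using upper_cone_resolvent_bound[OF z pos(2), of x] by simp
    show "integrable M (\<lambda>x. z * (1 / (z - of_real x)) - 1)"
      by (intro Bochner_Integration.integrable_diff integrable_mult_right integrable_resolvent Im) simp
  qed (use pos in \<open>auto intro!: cone_defect_integrable\<close>)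
  finally show ?thesis .
qed

text \<open>The analogous estimate for the difference quotient. With \<open>p = x / (z - x)\<close>
  and \<open>q = x / (w - x)\<close> the integrand is \<open>p + q + p * q\<close>; the factor
  \<open>\<alpha> + 4\<close> is \<open>1 + 1 + (\<alpha> + 2)\<close>.\<close>

lemma resolvent_mult_asymp:
  assumes z: "z \<in> upper_cone \<alpha> \<beta>" and w: "w \<in> upper_cone \<alpha> \<beta>" and pos: "0 < \<alpha>" "0 < \<beta>"
  shows "norm (z * w * (\<integral>x. 1 / ((z - of_real x) * (w - of_real x)) \<partial>M) - 1) \<le> (\<alpha> + 4) * cone_defect \<alpha> \<beta>"
proof -
  have Im: "0 < Im z" "0 < Im w" using upper_coneD[OF z] upper_coneD[OF w] by auto
  have "z * w * (\<integral>x. 1 / ((z - of_real x) * (w - of_real x)) \<partial>M) - 1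
    = (\<integral>x. z * w * (1 / ((z - of_real x) * (w - of_real x))) - 1 \<partial>M)"
  proof -
    have "integrable M (\<lambda>x. z * w * (1 / ((z - of_real x) * (w - of_real x))))"
      by (intro integrable_mult_right integrable_resolvent_mult Im)
    from Bochner_Integration.integral_diff[OF this integrable_const[of 1]] show ?thesis
      by (simp only: integral_mult_right_zero) (simp add: prob_space[simplified])
  qed
  also have "norm \<dots> \<le> (\<integral>x. (\<alpha> + 4) * min (\<alpha> + 2) (\<bar>x\<bar> / \<beta>) \<partial>M)"
  proof (rule Bochner_Integration.integral_norm_bound_integral)
    fix x
    let ?m = "min (\<alpha> + 2) (\<bar>x\<bar> / \<beta>)"
    let ?p = "of_real x / (z - of_real x)" and ?q = "of_real x / (w - of_real x)"
    have "z * w * (1 / ((z - of_real x) * (w - of_real x))) - 1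
      = (z / (z - of_real x)) * (w / (w - of_real x)) - 1" by simp
    also have "z / (z - of_real x) = 1 + ?p"
      using neq_of_real[OF Im(1), of x] by (simp add: field_simps)
    also have "w / (w - of_real x) = 1 + ?q"
      using neq_of_real[OF Im(2), of x] by (simp add: field_simps)
    also have "(1 + ?p) * (1 + ?q) - 1 = ?p + ?q + ?p * ?q" by (simp only: algebra_simps) simp
    also have "norm \<dots> \<le> norm ?p + norm ?q + norm ?p * norm ?q"
      by (metis add_mono norm_mult norm_triangle_ineq norm_triangle_le order_refl)
    also have "\<dots> \<le> ?m + ?m + (\<alpha> + 2) * ?m"
    proof -
      have "norm ?p \<le> ?m" "norm ?q \<le> ?m"
        using upper_cone_resolvent_bound[OF z pos(2), of x] upper_cone_resolvent_bound[OF w pos(2), of x] by auto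
      moreover then have "norm ?p * norm ?q \<le> (\<alpha> + 2) * ?m"
        using pos by (intro mult_mono) auto
      ultimately show ?thesis by linarith
    qed
    also have "\<dots> = (\<alpha> + 4) * ?m" by (simp add: algebra_simps)
    finally show "norm (z * w * (1 / ((z - of_real x) * (w - of_real x))) - 1) \<le> (\<alpha> + 4) * ?m" .
    show "integrable M (\<lambda>x. z * w * (1 / ((z - of_real x) * (w - of_real x))) - 1)"
      by (intro Bochner_Integration.integrable_diff integrable_mult_right integrable_resolvent_mult Im) simp
  qed (use pos in \<open>auto intro!: cone_defect_integrable\<close>)
  also have "\<dots> = (\<alpha> + 4) * cone_defect \<alpha> \<beta>"
    unfolding cone_defect_def by (rule integral_mult_right_zero)
  finally show ?thesis .
qed

text \<open>Smallness puts \<open>z * w\<close> times the difference quotient within distance less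
  than 1 of 1, so the quotient cannot vanish.\<close>

lemma inj_on_cauchy_transform_cone:
  assumes pos: "0 < \<alpha>" "0 < \<beta>" and small: "(\<alpha> + 4) * cone_defect \<alpha> \<beta> < 1"
  shows "inj_on (cauchy_transform M) (upper_cone \<alpha> \<beta>)"
proof (rule inj_onI)
  fix z w assume zw: "z \<in> upper_cone \<alpha> \<beta>" "w \<in> upper_cone \<alpha> \<beta>"
    and eq: "cauchy_transform M z = cauchy_transform M w"
  have Im: "0 < Im z" "0 < Im w" using zw by (auto simp: upper_cone_def)
  let ?D = "\<integral>x. 1 / ((z - of_real x) * (w - of_real x)) \<partial>M"
  have "norm (z * w * ?D - 1) < 1"
    using resolvent_mult_asymp[OF zw pos] small by linarith
  then have "?D \<noteq> 0" by auto
  moreover have "(w - z) * ?D = 0"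
    using cauchy_transform_diff[OF Im] eq by simp
  ultimately show "z = w" by simp
qed

lemma inj_on_cauchy_transform_cone_ex:
  assumes "0 < \<alpha>"
  obtains \<beta> where "0 < \<beta>" "inj_on (cauchy_transform M) (upper_cone \<alpha> \<beta>)"
proof -
  obtain \<beta> where \<beta>: "0 \<le> \<beta>" "0 < \<beta>" "cone_defect \<alpha> \<beta> < 1 / (\<alpha> + 4)"
    using cone_defect_small[OF assms, of "1 / (\<alpha> + 4)" 0] assms by auto
  show thesis
    using \<beta> assms by (intro that[of \<beta>] inj_on_cauchy_transform_cone) (auto simp: field_simps)
qed

text \<open>Writing \<open>w\<^sub>0 = 1 / z\<close>, a solution of \<open>G w = z\<close> is a fixed point of
  \<open>w \<mapsto> w\<^sub>0 + (w - 1 / G w)\<close>, whose correction term is small relative to \<open>w\<close> in the cone;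
  Brouwer's theorem on a disc around \<open>w\<^sub>0\<close> applies.\<close>

lemma inversion_params_ex:
  assumes \<gamma>: "0 < \<gamma>"
  obtains \<alpha> \<beta> \<delta> where "inversion_params M \<gamma> \<alpha> \<beta> \<delta>"
proof -
  \<comment> \<open>Since \<open>norm w0 \<le> (\<gamma> + 1) * Im w0\<close>, this choice of
    \<open>r\<close> makes the disc around \<open>w0\<close> have radius at most
    \<open>Im w0 / 2\<close>; its points have height at least \<open>Im w0 / 2\<close> and real part
    below \<open>(\<gamma> + 1/2) * Im w0\<close>, whence the aperture
    \<open>2 * \<gamma> + 1\<close>.\<close>
  define \<alpha> where "\<alpha> = 2 * \<gamma> + 1"
  define r where "r = 1 / (2 * (\<gamma> + 1))"
  have r: "0 < r" "r \<le> 1/2" and \<alpha>: "0 < \<alpha>" using \<gamma> by (auto simp: r_def \<alpha>_def field_simps)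
  \<comment> \<open>The bound \<open>r / 4\<close> makes the Brouwer map preserve the disc, the
    bound \<open>1 / (\<alpha> + 4)\<close> gives injectivity.\<close>
  have \<eta>: "0 < min (r / 4) (1 / (\<alpha> + 4))" using r \<alpha> by auto
  obtain \<beta> where \<beta>: "0 < \<beta>" and d: "cone_defect \<alpha> \<beta> < min (r / 4) (1 / (\<alpha> + 4))"
    using cone_defect_small[OF \<alpha> \<eta>] by blast
  have inj: "inj_on (cauchy_transform M) (upper_cone \<alpha> \<beta>)"
    using d \<alpha> \<beta> by (intro inj_on_cauchy_transform_cone) (auto simp: field_simps)
  \<comment> \<open>Chosen so that \<open>norm z < \<delta>\<close> forces
    \<open>Im w0 > 2 * \<beta>\<close>, which leaves the whole disc above height \<beta>.\<close>
  define \<delta> where "\<delta> = 1 / (2 * \<beta> * (\<gamma> + 1))"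
  have \<delta>: "0 < \<delta>" using \<beta> \<gamma> by (simp add: \<delta>_def)
  have "z \<in> cauchy_transform M ` upper_cone \<alpha> \<beta>" if z: "z \<in> lower_cone \<gamma> \<delta>" for z
  proof -
    have z': "Im z < 0" "\<bar>Re z\<bar> < \<gamma> * \<bar>Im z\<bar>" "norm z < \<delta>" "z \<noteq> 0"
      using z by (auto simp: lower_cone_def)
    define w0 where "w0 = 1 / z"
    have nz: "0 < norm z" using z' by simp
    have Re0: "Re w0 = Re z / (norm z)\<^sup>2" and Im0: "Im w0 = \<bar>Im z\<bar> / (norm z)\<^sup>2"
      using z' by (auto simp: w0_def Re_divide Im_divide cmod_power2)
    have cone0: "\<bar>Re w0\<bar> < \<gamma> * Im w0" "0 < Im w0"
      using z' nz by (auto simp: Re0 Im0 field_simps)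
    have n0: "norm w0 \<le> (\<gamma> + 1) * Im w0"
      using cmod_le[of w0] cone0 by (simp add: algebra_simps)
    have "1 / \<delta> < norm w0"
      using z' nz \<delta> by (simp add: w0_def norm_divide field_simps)
    then have "2 * \<beta> * (\<gamma> + 1) < (\<gamma> + 1) * Im w0" using n0 by (simp add: \<delta>_def)
    then have big: "2 * \<beta> < Im w0" using \<gamma> by (simp add: mult.commute)
    have rn: "r * norm w0 \<le> Im w0 / 2"
      using n0 \<gamma> by (simp add: r_def field_simps)
    let ?D = "cball w0 (r * norm w0)"
    have D: "w \<in> upper_cone \<alpha> \<beta>" "norm w \<le> 2 * norm w0" if "w \<in> ?D" for w
    proof -
      have "norm (w0 - w) \<le> r * norm w0" using that by (simp add: dist_norm)
      then have *: "norm (w0 - w) \<le> Im w0 / 2" and **: "norm (w0 - w) \<le> norm w0"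
        using rn r mult_right_mono[of r 1 "norm w0"] by auto
      have "\<bar>Im w0 - Im w\<bar> \<le> Im w0 / 2" "\<bar>Re w0 - Re w\<bar> \<le> Im w0 / 2"
        using abs_Im_le_cmod[of "w0 - w"] abs_Re_le_cmod[of "w0 - w"] * by auto
      then have i: "Im w0 / 2 \<le> Im w" and "\<bar>Re w\<bar> \<le> \<bar>Re w0\<bar> + Im w0 / 2" by linarith+
      then have "\<bar>Re w\<bar> < (2 * \<gamma> + 1) * (Im w0 / 2)" using cone0 by (simp add: algebra_simps)
      also have "\<dots> \<le> \<alpha> * Im w" unfolding \<alpha>_def using i \<gamma> by (intro mult_left_mono) auto
      finally show "w \<in> upper_cone \<alpha> \<beta>"
        using i big cone0 by (simp add: upper_cone_def)
      show "norm w \<le> 2 * norm w0"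
        using ** norm_triangle_sub[of w w0] by (simp add: norm_minus_commute)
    qed
    have G: "norm (w * cauchy_transform M w - 1) \<le> r / 4" "cauchy_transform M w \<noteq> 0" if "w \<in> ?D" for w
    proof -
      show *: "norm (w * cauchy_transform M w - 1) \<le> r / 4"
        using cauchy_transform_asymp[OF D(1)[OF that] \<alpha> \<beta>] d by simp
      show "cauchy_transform M w \<noteq> 0" using * r by auto
    qed
    have cont: "continuous_on ?D (\<lambda>w. w0 + (w - 1 / cauchy_transform M w))"
      using D(1) upper_cone_subset G(2)
      by (intro continuous_intros continuous_on_subset[OF continuous_on_cauchy_transform]) blast+
    have maps: "w0 + (w - 1 / cauchy_transform M w) \<in> ?D" if w: "w \<in> ?D" for w
    proof -
      let ?G = "cauchy_transform M w"
      have "norm (w * ?G) \<ge> 1 / 2"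
        using G(1)[OF w] r norm_triangle_sub[of 1 "w * ?G"] by (simp add: norm_minus_commute)
      then have g: "1 / 2 \<le> norm w * norm ?G" by (simp add: norm_mult)
      have "norm (w - 1 / ?G) * norm ?G = norm (w * ?G - 1)"
        using G(2)[OF w] by (simp add: norm_mult[symmetric] algebra_simps)
      also have "\<dots> \<le> r / 4 * (2 * (norm w * norm ?G))"
        using G(1)[OF w] g mult_left_mono[of 1 "2 * (norm w * norm ?G)" "r / 4"] r by linarith
      also have "\<dots> \<le> r / 4 * (2 * (2 * norm w0 * norm ?G))"
        using D(2)[OF w] r by (intro mult_left_mono mult_right_mono) auto
      finally have "norm (w - 1 / ?G) * norm ?G \<le> (r * norm w0) * norm ?G" by (simp add: algebra_simps)
      then have "norm (w - 1 / ?G) \<le> r * norm w0" using G(2)[OF w] by simp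
      then show ?thesis by (simp add: dist_norm norm_minus_commute)
    qed
    have "w0 \<in> ?D" using r by simp
    then have ne: "?D \<noteq> {}" by blast
    obtain w where w: "w \<in> ?D" "w0 + (w - 1 / cauchy_transform M w) = w"
      by (rule brouwer[OF compact_cball convex_cball ne cont]) (use maps in auto)
    then have "cauchy_transform M w = z"
      using G(2)[OF w(1)] z'(4) by (auto simp: w0_def field_simps)
    then show ?thesis using D(1)[OF w(1)] by blast
  qed
  then have "inversion_params M \<gamma> \<alpha> \<beta> \<delta>"
    using \<alpha> \<beta> \<gamma> \<delta> inj by (auto simp: inversion_params_def)
  then show thesis by (rule that)
qed

section \<open>Independence of the inverse from the cone\<close>

lemma cauchy_transform_small_imp_Im_large:
  assumes "0 < \<alpha>" "0 < \<beta>" "0 < B"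
  obtains \<delta> where "0 < \<delta>"
    "\<And>w. w \<in> upper_cone \<alpha> \<beta> \<Longrightarrow> norm (cauchy_transform M w) < \<delta> \<Longrightarrow> B < Im w"
proof -
  let ?h = "\<lambda>x. 1 / (\<alpha> * B + B + \<bar>x\<bar>)\<^sup>2"
  \<comment> \<open>A positive lower bound for the energy at every point of the cone of height at
    most \<open>B\<close>, since there
    \<open>norm (w - x) \<le> \<alpha> * B + B + \<bar>x\<bar>\<close>. As
    \<open>Im w > \<beta>\<close>, such a point has \<open>- Im (G w) \<ge> \<beta> * c\<close>, so
    smaller values of \<open>G\<close> are attained only higher up.\<close>
  define c where "c = (\<integral>x. ?h x \<partial>M)"
  have p: "0 < \<alpha> * B + B" using assms by (simp add: add_pos_pos)
  have i: "integrable M ?h"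
  proof (rule integrable_const_bound[where B="1 / (\<alpha> * B + B)\<^sup>2"])
    show "AE x in M. norm (?h x) \<le> 1 / (\<alpha> * B + B)\<^sup>2"
      using p by (intro AE_I2) (auto intro!: divide_left_mono power_mono)
  qed auto
  have "0 \<le> c" unfolding c_def by (intro integral_nonneg_AE) auto
  moreover have "c \<noteq> 0"
  proof
    assume "c = 0"
    then have "AE x in M. ?h x = 0"
      unfolding c_def using i by (subst (asm) integral_nonneg_eq_0_iff_AE) auto
    then have "AE x in M. False"
      by eventually_elim (use p in auto)
    then show False by simp
  qed
  ultimately have c: "0 < c" by simp
  show thesis
  proof (rule that[of "\<beta> * c"])
    show "0 < \<beta> * c" using assms c by simp
    fix w assume w: "w \<in> upper_cone \<alpha> \<beta>" and small: "norm (cauchy_transform M w) < \<beta> * c"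
    note w = upper_coneD[OF w]
    show "B < Im w"
    proof (rule ccontr)
      assume "\<not> B < Im w"
      then have le: "Im w \<le> B" by simp
      have "norm (w - of_real x) \<le> \<alpha> * B + B + \<bar>x\<bar>" for x
      proof -
        have "norm (w - of_real x) \<le> norm w + \<bar>x\<bar>"
          by (metis norm_of_real norm_triangle_ineq4)
        also have "norm w \<le> \<bar>Re w\<bar> + \<bar>Im w\<bar>" by (rule cmod_le)
        also have "\<dots> \<le> \<alpha> * B + B" using w le assms mult_left_mono[of "Im w" B \<alpha>] by linarith
        finally show ?thesis by simp
      qed
      then have "c \<le> resolvent_energy w"
        unfolding c_def resolvent_energy_def using w
        by (intro Bochner_Integration.integral_mono i integrable_resolvent_norm divide_left_mono power_mono)
          (auto simp: neq_of_real intro!: mult_pos_pos zero_less_power add_pos_nonneg p)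
      then have "\<beta> * c \<le> Im w * resolvent_energy w"
        using w assms c by (intro mult_mono) auto
      also have "\<dots> \<le> \<bar>Im (cauchy_transform M w)\<bar>"
        using w by (simp add: Im_cauchy_transform)
      also have "\<dots> \<le> norm (cauchy_transform M w)" by (rule abs_Im_le_cmod)
      finally show False using small by simp
    qed
  qed
qed

lemma inversion_params_inverse:
  assumes "inversion_params M \<gamma> \<alpha> \<beta> \<delta>"
  obtains g where "g holomorphic_on lower_cone \<gamma> \<delta>"
    "\<And>z. z \<in> lower_cone \<gamma> \<delta> \<Longrightarrow> g z \<in> upper_cone \<alpha> \<beta>"
    "\<And>z. z \<in> lower_cone \<gamma> \<delta> \<Longrightarrow> cauchy_transform M (g z) = z"
    "\<And>w. w \<in> upper_cone \<alpha> \<beta> \<Longrightarrow> g (cauchy_transform M w) = w"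
proof -
  note p = inversion_paramsD[OF assms]
  obtain g where g: "g holomorphic_on (cauchy_transform M ` upper_cone \<alpha> \<beta>)"
    "\<And>w. w \<in> upper_cone \<alpha> \<beta> \<Longrightarrow> g (cauchy_transform M w) = w"
    using holomorphic_has_inverse[OF holomorphic_on_subset[OF holomorphic_cauchy_transform upper_cone_subset]
      open_upper_cone p(5)] by metis
  show thesis
  proof (rule that)
    show "g holomorphic_on lower_cone \<gamma> \<delta>" using g(1) p(6) by (rule holomorphic_on_subset)
    show "g z \<in> upper_cone \<alpha> \<beta>" "cauchy_transform M (g z) = z" if "z \<in> lower_cone \<gamma> \<delta>" for z
      using g(2) p(6) that by fastforce+
  qed (use g in auto)
qed

text \<open>Preimages of a small value lie high up, whichever cone they come from; there both belong
  to the cone of the larger aperture, on which \<open>G\<close> is injective.\<close>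

lemma inverse_unique_near_0:
  assumes "0 < \<alpha>" "0 < \<beta>" "0 < \<alpha>'" "0 < \<beta>'"
  obtains \<delta> where "0 < \<delta>"
    "\<And>w w'. w \<in> upper_cone \<alpha> \<beta> \<Longrightarrow> w' \<in> upper_cone \<alpha>' \<beta>' \<Longrightarrow>
      cauchy_transform M w = cauchy_transform M w' \<Longrightarrow> norm (cauchy_transform M w) < \<delta> \<Longrightarrow> w = w'"
proof -
  have "0 < max \<alpha> \<alpha>'" using assms by simp
  then obtain B where B: "0 < B" "inj_on (cauchy_transform M) (upper_cone (max \<alpha> \<alpha>') B)"
    using inj_on_cauchy_transform_cone_ex by blast
  obtain d where d: "0 < d"
    "\<And>w. w \<in> upper_cone \<alpha> \<beta> \<Longrightarrow> norm (cauchy_transform M w) < d \<Longrightarrow> B < Im w"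
    using cauchy_transform_small_imp_Im_large[OF assms(1,2) B(1)] by blast
  obtain d' where d': "0 < d'"
    "\<And>w. w \<in> upper_cone \<alpha>' \<beta>' \<Longrightarrow> norm (cauchy_transform M w) < d' \<Longrightarrow> B < Im w"
    using cauchy_transform_small_imp_Im_large[OF assms(3,4) B(1)] by blast
  show thesis
  proof (rule that[of "min d d'"])
    fix w w' assume w: "w \<in> upper_cone \<alpha> \<beta>" and w': "w' \<in> upper_cone \<alpha>' \<beta>'"
      and eq: "cauchy_transform M w = cauchy_transform M w'" and "norm (cauchy_transform M w) < min d d'"
    then have "B < Im w" "B < Im w'" using d(2)[OF w] d'(2)[OF w'] by auto
    moreover have "\<bar>Re w\<bar> < max \<alpha> \<alpha>' * Im w" "\<bar>Re w'\<bar> < max \<alpha> \<alpha>' * Im w'"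
    proof -
      have "\<alpha> * Im w \<le> max \<alpha> \<alpha>' * Im w" "\<alpha>' * Im w' \<le> max \<alpha> \<alpha>' * Im w'"
        using upper_coneD[OF w] upper_coneD[OF w'] by (auto intro!: mult_right_mono)
      then show "\<bar>Re w\<bar> < max \<alpha> \<alpha>' * Im w" "\<bar>Re w'\<bar> < max \<alpha> \<alpha>' * Im w'"
        using upper_coneD[OF w] upper_coneD[OF w'] by linarith+
    qed
    ultimately have "w \<in> upper_cone (max \<alpha> \<alpha>') B" "w' \<in> upper_cone (max \<alpha> \<alpha>') B"
      using B(1) by (auto simp: upper_cone_def)
    then show "w = w'" using B(2) eq by (auto dest: inj_onD)
  qed (use d d' in auto)
qed

text \<open>Two local inverses agree on a small cone at 0 by the preceding lemma, hence on the
  intersection of their domains by the identity theorem. This is what makes the definite description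
  in \<open>cauchy_inverse\<close> meaningful.\<close>

lemma inverse_unique:
  assumes p: "inversion_params M \<gamma> \<alpha> \<beta> \<delta>" and p': "inversion_params M \<gamma>' \<alpha>' \<beta>' \<delta>'"
    and z: "z \<in> lower_cone \<gamma> \<delta>" "z \<in> lower_cone \<gamma>' \<delta>'"
    and w: "w \<in> upper_cone \<alpha> \<beta>" "cauchy_transform M w = z"
    and w': "w' \<in> upper_cone \<alpha>' \<beta>'" "cauchy_transform M w' = z"
  shows "w = w'"
proof -
  obtain g where g: "g holomorphic_on lower_cone \<gamma> \<delta>"
    "\<And>z. z \<in> lower_cone \<gamma> \<delta> \<Longrightarrow> g z \<in> upper_cone \<alpha> \<beta>"
    "\<And>z. z \<in> lower_cone \<gamma> \<delta> \<Longrightarrow> cauchy_transform M (g z) = z"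
    "\<And>w. w \<in> upper_cone \<alpha> \<beta> \<Longrightarrow> g (cauchy_transform M w) = w"
    by (rule inversion_params_inverse[OF p]) blast
  obtain g' where g': "g' holomorphic_on lower_cone \<gamma>' \<delta>'"
    "\<And>z. z \<in> lower_cone \<gamma>' \<delta>' \<Longrightarrow> g' z \<in> upper_cone \<alpha>' \<beta>'"
    "\<And>z. z \<in> lower_cone \<gamma>' \<delta>' \<Longrightarrow> cauchy_transform M (g' z) = z"
    "\<And>w. w \<in> upper_cone \<alpha>' \<beta>' \<Longrightarrow> g' (cauchy_transform M w) = w"
    by (rule inversion_params_inverse[OF p']) blast
  note p = inversion_paramsD[OF p] and p' = inversion_paramsD[OF p']
  obtain d where d: "0 < d" "\<And>w w'. w \<in> upper_cone \<alpha> \<beta> \<Longrightarrow> w' \<in> upper_cone \<alpha>' \<beta>' \<Longrightarrow>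
      cauchy_transform M w = cauchy_transform M w' \<Longrightarrow> norm (cauchy_transform M w) < d \<Longrightarrow> w = w'"
    using inverse_unique_near_0[OF p(2,3) p'(2,3)] by blast
  let ?L = "lower_cone \<gamma> \<delta> \<inter> lower_cone \<gamma>' \<delta>'"
  let ?S = "lower_cone (min \<gamma> \<gamma>') (min d (min \<delta> \<delta>'))"
  have "g z = g' z"
  proof (rule analytic_continuation_open[where s = ?S and s' = ?L and f = g and g = g' and z = z])
    show "?S \<noteq> {}" using p p' d by (intro lower_cone_nonempty) auto
    show sub: "?S \<subseteq> ?L" unfolding lower_cone_Int by (intro lower_cone_mono) auto
    show "connected ?L" unfolding lower_cone_Int by (rule connected_lower_cone)
    show "g holomorphic_on ?L" "g' holomorphic_on ?L"
      using g(1) g'(1) by (auto elim: holomorphic_on_subset)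
    show "g y = g' y" if "y \<in> ?S" for y
    proof (rule d(2))
      have y: "y \<in> lower_cone \<gamma> \<delta>" "y \<in> lower_cone \<gamma>' \<delta>'" using that sub by auto
      show "g y \<in> upper_cone \<alpha> \<beta>" "g' y \<in> upper_cone \<alpha>' \<beta>'"
        "cauchy_transform M (g y) = cauchy_transform M (g' y)"
        using y g(2,3) g'(2,3) by auto
      show "norm (cauchy_transform M (g y)) < d" using g(3)[OF y(1)] that by (simp add: lower_cone_def)
    qed
  qed (use z open_lower_cone in auto)
  then show ?thesis using w w' g(4) g'(4) by metis
qed

lemma cauchy_inverse_eqI:
  assumes "inversion_params M \<gamma> \<alpha> \<beta> \<delta>" "z \<in> lower_cone \<gamma> \<delta>" "w \<in> upper_cone \<alpha> \<beta>"
    "cauchy_transform M w = z"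
  shows "cauchy_inverse M z = w"
  unfolding cauchy_inverse_def
proof (rule the_equality)
  show "\<exists>\<gamma> \<alpha> \<beta> \<delta>. inversion_params M \<gamma> \<alpha> \<beta> \<delta> \<and> z \<in> lower_cone \<gamma> \<delta> \<and>
     w \<in> upper_cone \<alpha> \<beta> \<and> cauchy_transform M w = z"
    using assms by blast
next
  fix w'
  assume "\<exists>\<gamma> \<alpha> \<beta> \<delta>. inversion_params M \<gamma> \<alpha> \<beta> \<delta> \<and> z \<in> lower_cone \<gamma> \<delta> \<and>
     w' \<in> upper_cone \<alpha> \<beta> \<and> cauchy_transform M w' = z"
  then obtain \<gamma>' \<alpha>' \<beta>' \<delta>' where *: "inversion_params M \<gamma>' \<alpha>' \<beta>' \<delta>'" "z \<in> lower_cone \<gamma>' \<delta>'"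
     "w' \<in> upper_cone \<alpha>' \<beta>'" "cauchy_transform M w' = z" by blast
  show "w' = w"
    by (rule inverse_unique[OF *(1) assms(1) *(2) assms(2) *(3,4) assms(3,4)])
qed

lemma cauchy_inverse_works:
  assumes "inversion_params M \<gamma> \<alpha> \<beta> \<delta>" "z \<in> lower_cone \<gamma> \<delta>"
  shows "cauchy_inverse M z \<in> upper_cone \<alpha> \<beta>" "cauchy_transform M (cauchy_inverse M z) = z"
proof -
  obtain w where "w \<in> upper_cone \<alpha> \<beta>" "cauchy_transform M w = z"
    using assms inversion_paramsD(6)[OF assms(1)] by blast
  then show "cauchy_inverse M z \<in> upper_cone \<alpha> \<beta>" "cauchy_transform M (cauchy_inverse M z) = z"
    using cauchy_inverse_eqI[OF assms] by auto
qed

lemma holomorphic_cauchy_inverse: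
  assumes "inversion_params M \<gamma> \<alpha> \<beta> \<delta>"
  shows "cauchy_inverse M holomorphic_on lower_cone \<gamma> \<delta>"
proof -
  obtain g where g: "g holomorphic_on lower_cone \<gamma> \<delta>"
    "\<And>z. z \<in> lower_cone \<gamma> \<delta> \<Longrightarrow> g z \<in> upper_cone \<alpha> \<beta>"
    "\<And>z. z \<in> lower_cone \<gamma> \<delta> \<Longrightarrow> cauchy_transform M (g z) = z"
    "\<And>w. w \<in> upper_cone \<alpha> \<beta> \<Longrightarrow> g (cauchy_transform M w) = w"
    by (rule inversion_params_inverse[OF assms]) blast
  show ?thesis
    using g(1)
  proof (rule holomorphic_transform)
    show "g z = cauchy_inverse M z" if "z \<in> lower_cone \<gamma> \<delta>" for z
      using cauchy_inverse_eqI[OF assms that g(2)[OF that] g(3)[OF that]] by simp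
  qed
qed

text \<open>The upper cone here is arbitrary, not one of an admissible choice of parameters. Thus
  any explicitly found preimage that stays in some cone is the value of the inverse once
  \<open>z\<close> is small; all computations of R-transforms go through this.\<close>

lemma cauchy_inverse_near_0:
  assumes "0 < \<gamma>" "0 < \<alpha>" "0 < \<beta>"
  obtains \<delta> where "0 < \<delta>" "lower_cone \<gamma> \<delta> \<subseteq> R_domain M"
    "\<And>z w. z \<in> lower_cone \<gamma> \<delta> \<Longrightarrow> w \<in> upper_cone \<alpha> \<beta> \<Longrightarrow> cauchy_transform M w = z \<Longrightarrow>
      cauchy_inverse M z = w"
proof -
  obtain \<alpha>' \<beta>' \<delta>' where p: "inversion_params M \<gamma> \<alpha>' \<beta>' \<delta>'"
    using inversion_params_ex[OF assms(1)] by blast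
  note p' = inversion_paramsD[OF p]
  obtain d where d: "0 < d" "\<And>w w'. w \<in> upper_cone \<alpha> \<beta> \<Longrightarrow> w' \<in> upper_cone \<alpha>' \<beta>' \<Longrightarrow>
      cauchy_transform M w = cauchy_transform M w' \<Longrightarrow> norm (cauchy_transform M w) < d \<Longrightarrow> w = w'"
    using inverse_unique_near_0[OF assms(2,3) p'(2,3)] by blast
  have sub: "lower_cone \<gamma> (min d \<delta>') \<subseteq> lower_cone \<gamma> \<delta>'" by (intro lower_cone_mono) auto
  show thesis
  proof (rule that[of "min d \<delta>'"])
    show "lower_cone \<gamma> (min d \<delta>') \<subseteq> R_domain M" using sub p unfolding R_domain_def by blast
    fix z w assume z: "z \<in> lower_cone \<gamma> (min d \<delta>')" and w: "w \<in> upper_cone \<alpha> \<beta>" "cauchy_transform M w = z"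
    have "w = cauchy_inverse M z"
    proof (rule d(2)[OF w(1)])
      have z': "z \<in> lower_cone \<gamma> \<delta>'" using sub z by blast
      show "cauchy_inverse M z \<in> upper_cone \<alpha>' \<beta>'"
        "cauchy_transform M w = cauchy_transform M (cauchy_inverse M z)"
        using cauchy_inverse_works[OF p z'] w by simp_all
      show "norm (cauchy_transform M w) < d" using z w by (simp add: lower_cone_def)
    qed
    then show "cauchy_inverse M z = w" ..
  qed (use d p' in auto)
qed

end

section \<open>The Cauchy transform determines the measure\<close>

text \<open>Without the usual factor \<open>1 / pi\<close>: the total mass is \<open>pi\<close>, and
  \<open>- Im G\<close> on a horizontal line is exactly the convolution of the measure with this
  kernel.\<close>

definition poisson_kernel :: "real \<Rightarrow> real \<Rightarrow> real" where
  "poisson_kernel y u = y / (u\<^sup>2 + y\<^sup>2)"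

lemma borel_measurable_poisson_kernel [measurable]:
  "poisson_kernel y \<in> borel_measurable borel"
  unfolding poisson_kernel_def by measurable

lemma poisson_kernel_nonneg: "0 < y \<Longrightarrow> 0 \<le> poisson_kernel y u"
  by (simp add: poisson_kernel_def)

lemma poisson_kernel_scale: "0 < y \<Longrightarrow> poisson_kernel y (y * u) = poisson_kernel 1 u / y"
proof -
  assume y: "0 < y"
  have "(y * u)\<^sup>2 + y\<^sup>2 = y * y * (u\<^sup>2 + 1)" by (simp add: power2_eq_square algebra_simps)
  with y show ?thesis by (simp add: poisson_kernel_def)
qed

lemma has_bochner_integral_poisson_kernel_1: "has_bochner_integral lborel (poisson_kernel 1) pi"
proof -
  have eq: "poisson_kernel 1 = (\<lambda>x. inverse (1 + x\<^sup>2))"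
    by (auto simp: poisson_kernel_def inverse_eq_divide add.commute)
  have "integrable lborel (poisson_kernel 1)"
    using integrable_inverse_1_plus_square by (simp add: eq set_integrable_def einterval_iff)
  moreover have "integral\<^sup>L lborel (poisson_kernel 1) = pi"
    using LBINT_inverse_1_plus_square
    by (simp add: eq interval_lebesgue_integral_def set_lebesgue_integral_def einterval_iff)
  ultimately show ?thesis by (simp add: has_bochner_integral_iff)
qed

lemma
  assumes y: "0 < y"
  shows integrable_poisson_kernel: "integrable lborel (\<lambda>x. poisson_kernel y (x - a))"
    and integral_poisson_kernel: "(\<integral>x. poisson_kernel y (x - a) \<partial>lborel) = pi"
proof -
  let ?f = "\<lambda>x. poisson_kernel y (x - a)"
  have sub: "?f (a + y * u) = poisson_kernel 1 u / y" for u
    using poisson_kernel_scale[OF y, of u] by simp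
  have p1: "integrable lborel (poisson_kernel 1)" "integral\<^sup>L lborel (poisson_kernel 1) = pi"
    using has_bochner_integral_poisson_kernel_1 by (auto simp: has_bochner_integral_iff)
  have "integrable lborel (\<lambda>u. ?f (a + y * u))"
    unfolding sub using p1 by simp
  then show "integrable lborel ?f"
    using lborel_integrable_real_affine_iff[of y ?f a] y by simp
  show "integral\<^sup>L lborel ?f = pi"
    using y p1(2) by (subst lborel_integral_real_affine[of y _ a]) (auto simp: poisson_kernel_scale)
qed

definition poisson_char :: "real \<Rightarrow> real \<Rightarrow> complex" where
  "poisson_char y \<tau> = (\<integral>x. iexp (\<tau> * x) * of_real (poisson_kernel y x) \<partial>lborel)"

lemma poisson_char_shift:
  "(\<integral>x. iexp (\<tau> * x) * of_real (poisson_kernel y (x - s)) \<partial>lborel) = iexp (\<tau> * s) * poisson_char y \<tau>"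
proof -
  have "(\<integral>x. iexp (\<tau> * x) * of_real (poisson_kernel y (x - s)) \<partial>lborel)
    = (\<integral>x. iexp (\<tau> * s) * (iexp (\<tau> * x) * of_real (poisson_kernel y x)) \<partial>lborel)"
    by (subst lborel_integral_real_affine[of 1 _ s]) (auto simp: algebra_simps exp_add)
  also have "\<dots> = iexp (\<tau> * s) * poisson_char y \<tau>"
    unfolding poisson_char_def by (rule integral_mult_right_zero)
  finally show ?thesis .
qed

text \<open>After the substitution \<open>x = y * u\<close> the frequency becomes
  \<open>\<tau> * y\<close>, so by dominated convergence the value tends to the total mass
  \<open>pi\<close> as \<open>y\<close> tends to 0.\<close>

lemma poisson_char_nonzero_ex: "\<exists>y>0. poisson_char y \<tau> \<noteq> 0"
proof -
  let ?y = "\<lambda>n. 1 / real (Suc n)"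
  let ?f = "\<lambda>n u. iexp (\<tau> * (?y n * u)) * complex_of_real (poisson_kernel 1 u)"
  have p1: "integrable lborel (poisson_kernel 1)" "integral\<^sup>L lborel (poisson_kernel 1) = pi"
    using has_bochner_integral_poisson_kernel_1 by (auto simp: has_bochner_integral_iff)
  have eq: "poisson_char (?y n) \<tau> = (\<integral>u. ?f n u \<partial>lborel)" for n
  proof -
    have "poisson_char (?y n) \<tau> = \<bar>?y n\<bar> *\<^sub>R (\<integral>u. iexp (\<tau> * (0 + ?y n * u)) *
      complex_of_real (poisson_kernel (?y n) (0 + ?y n * u)) \<partial>lborel)"
      unfolding poisson_char_def by (rule lborel_integral_real_affine) simp
    also have "\<dots> = (\<integral>u. ?y n *\<^sub>R (iexp (\<tau> * (?y n * u)) * complex_of_real (poisson_kernel (?y n) (?y n * u))) \<partial>lborel)"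
      by (simp del: integral_scaleR_right add: integral_scaleR_right[symmetric])
    also have "\<dots> = (\<integral>u. ?f n u \<partial>lborel)"
      by (intro Bochner_Integration.integral_cong refl, subst poisson_kernel_scale)
         (auto simp: scaleR_conv_of_real simp del: of_nat_Suc)
    finally show ?thesis .
  qed
  have "(\<lambda>n. \<integral>u. ?f n u \<partial>lborel) \<longlonglongrightarrow> (\<integral>u. complex_of_real (poisson_kernel 1 u) \<partial>lborel)"
  proof (rule integral_dominated_convergence[where w="poisson_kernel 1"])
    show "AE u in lborel. (\<lambda>n. ?f n u) \<longlonglongrightarrow> complex_of_real (poisson_kernel 1 u)"
    proof (rule AE_I2)
      fix u
      have "(\<lambda>n. ?y n) \<longlonglongrightarrow> 0"
        using LIMSEQ_Suc[OF lim_const_over_n[of "1::real"]] by simp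
      then have "(\<lambda>n. ?f n u) \<longlonglongrightarrow> iexp (\<tau> * (0 * u)) * complex_of_real (poisson_kernel 1 u)"
        by (intro tendsto_intros)
      then show "(\<lambda>n. ?f n u) \<longlonglongrightarrow> complex_of_real (poisson_kernel 1 u)" by simp
    qed
    show "AE u in lborel. norm (?f n u) \<le> poisson_kernel 1 u" for n
      using poisson_kernel_nonneg[of 1] by (auto simp: norm_mult simp del: of_real_mult)
  qed (use p1 in auto)
  then have "(\<lambda>n. poisson_char (?y n) \<tau>) \<longlonglongrightarrow> of_real pi"
    unfolding eq using p1 by (simp add: integral_complex_of_real)
  then have "\<forall>\<^sub>F n in sequentially. poisson_char (?y n) \<tau> \<noteq> 0"
    by (rule tendsto_imp_eventually_ne) simp
  then obtain n where "poisson_char (?y n) \<tau> \<noteq> 0"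
    by (auto simp: eventually_sequentially)
  then show ?thesis by (intro exI[of _ "?y n"]) simp
qed

context real_distribution
begin

lemma Im_cauchy_transform_poisson:
  assumes "0 < y"
  shows "Im (cauchy_transform M (Complex x y)) = - (\<integral>s. poisson_kernel y (x - s) \<partial>M)"
proof -
  have "(\<integral>s. poisson_kernel y (x - s) \<partial>M) = (\<integral>s. y * (1 / (norm (Complex x y - of_real s))\<^sup>2) \<partial>M)"
    by (intro Bochner_Integration.integral_cong) (auto simp: poisson_kernel_def cmod_power2)
  also have "\<dots> = y * resolvent_energy (Complex x y)"
    unfolding resolvent_energy_def by (rule integral_mult_right_zero)
  finally show ?thesis using assms by (simp add: Im_cauchy_transform)
qed

lemma char_mult_poisson_char:
  assumes y: "0 < y"
  shows "char M \<tau> * poisson_char y \<tau> =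
    (\<integral>x. iexp (\<tau> * x) * of_real (- Im (cauchy_transform M (Complex x y))) \<partial>lborel)"
proof -
  interpret pair_sigma_finite M lborel ..
  let ?f = "\<lambda>s x. iexp (\<tau> * x) * complex_of_real (poisson_kernel y (x - s))"
  have "integrable (M \<Otimes>\<^sub>M lborel) (case_prod ?f)"
  proof (rule Fubini_integrable)
    have "norm (?f s x) = poisson_kernel y (x - s)" for s x
      using poisson_kernel_nonneg[OF y, of "x - s"] by (simp add: norm_mult del: of_real_mult)
    then show "integrable M (\<lambda>s. \<integral>x. norm (case_prod ?f (s, x)) \<partial>lborel)"
      using integral_poisson_kernel[OF y] by simp
    show "AE s in M. integrable lborel (\<lambda>x. case_prod ?f (s, x))"
    proof (rule AE_I2)
      fix s
      show "integrable lborel (\<lambda>x. case_prod ?f (s, x))"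
        by (rule Bochner_Integration.integrable_bound[OF integrable_poisson_kernel[OF y, of s]])
          (auto simp: norm_mult simp del: of_real_mult)
    qed
  qed (unfold poisson_kernel_def, measurable)
  then have "(\<integral>x. (\<integral>s. ?f s x \<partial>M) \<partial>lborel) = (\<integral>s. (\<integral>x. ?f s x \<partial>lborel) \<partial>M)"
    by (rule Fubini_integral)
  also have "\<dots> = char M \<tau> * poisson_char y \<tau>"
    unfolding poisson_char_shift char_def by (rule integral_mult_left_zero)
  also have "(\<lambda>x. \<integral>s. ?f s x \<partial>M) = (\<lambda>x. iexp (\<tau> * x) * of_real (- Im (cauchy_transform M (Complex x y))))"
  proof
    fix x
    have "(\<integral>s. ?f s x \<partial>M) = iexp (\<tau> * x) * (\<integral>s. complex_of_real (poisson_kernel y (x - s)) \<partial>M)"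
      by (rule integral_mult_right_zero)
    then show "(\<integral>s. ?f s x \<partial>M) = iexp (\<tau> * x) * of_real (- Im (cauchy_transform M (Complex x y)))"
      unfolding Im_cauchy_transform_poisson[OF y] by (simp add: integral_complex_of_real)
  qed
  finally show ?thesis by simp
qed

end

text \<open>The measure with density \<open>- Im G(x + \<i>y) / \<pi>\<close> is the convolution with a Cauchy law, and
  characteristic functions turn this convolution into a product.\<close>

lemma cauchy_transform_unique:
  assumes "real_distribution \<mu>" "real_distribution \<nu>"
    and "\<And>z. 0 < Im z \<Longrightarrow> cauchy_transform \<mu> z = cauchy_transform \<nu> z"
  shows "\<mu> = \<nu>"
proof (rule Levy_uniqueness[OF assms(1,2)], rule ext)
  fix \<tau>
  obtain y where y: "0 < y" "poisson_char y \<tau> \<noteq> 0"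
    using poisson_char_nonzero_ex by blast
  have "char \<mu> \<tau> * poisson_char y \<tau> = char \<nu> \<tau> * poisson_char y \<tau>"
    using real_distribution.char_mult_poisson_char[OF assms(1) y(1)]
      real_distribution.char_mult_poisson_char[OF assms(2) y(1)] assms(3) y(1) by simp
  then show "char \<mu> \<tau> = char \<nu> \<tau>" using y(2) by simp
qed

lemma cauchy_transform_unique_open:
  assumes \<mu>: "real_distribution \<mu>" and \<nu>: "real_distribution \<nu>"
    and S: "open S" "S \<noteq> {}" "S \<subseteq> upper_half_plane"
    and eq: "\<And>z. z \<in> S \<Longrightarrow> cauchy_transform \<mu> z = cauchy_transform \<nu> z"
  shows "\<mu> = \<nu>"
proof (rule cauchy_transform_unique[OF \<mu> \<nu>])
  fix z :: complex assume "0 < Im z"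
  then have z: "z \<in> upper_half_plane" by simp
  show "cauchy_transform \<mu> z = cauchy_transform \<nu> z"
    using analytic_continuation_open[OF S(1) open_upper_half_plane S(2) connected_upper_half_plane S(3)
        real_distribution.holomorphic_cauchy_transform[OF \<mu>]
        real_distribution.holomorphic_cauchy_transform[OF \<nu>] eq z] .
qed

lemma R_transform_eq_iff: "R_transform \<mu> z = R_transform \<nu> z \<longleftrightarrow> cauchy_inverse \<mu> z = cauchy_inverse \<nu> z"
  by (simp add: R_transform_def)

text \<open>Equal R-transforms mean equal inverses on a small cone; transported back through
  \<open>G\<close>, this gives equality of the Cauchy transforms on a nonempty open set, which
  determines the measure.\<close>

lemma R_transform_unique:
  assumes \<mu>: "real_distribution \<mu>" and \<nu>: "real_distribution \<nu>" and pos: "0 < \<gamma>" "0 < \<delta>"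
    and eq: "\<And>z. z \<in> lower_cone \<gamma> \<delta> \<Longrightarrow> R_transform \<mu> z = R_transform \<nu> z"
  shows "\<mu> = \<nu>"
proof -
  interpret \<mu>: real_distribution \<mu> by (rule \<mu>)
  interpret \<nu>: real_distribution \<nu> by (rule \<nu>)
  obtain \<alpha> \<beta> d where p: "inversion_params \<mu> \<gamma> \<alpha> \<beta> d"
    using \<mu>.inversion_params_ex[OF pos(1)] by blast
  obtain \<alpha>' \<beta>' d' where p': "inversion_params \<nu> \<gamma> \<alpha>' \<beta>' d'"
    using \<nu>.inversion_params_ex[OF pos(1)] by blast
  let ?e = "min \<delta> (min d d')"
  have e: "0 < ?e" using pos inversion_paramsD[OF p] inversion_paramsD[OF p'] by simp
  have sub: "lower_cone \<gamma> ?e \<subseteq> lower_cone \<gamma> \<delta>" "lower_cone \<gamma> ?e \<subseteq> lower_cone \<gamma> d"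
    "lower_cone \<gamma> ?e \<subseteq> lower_cone \<gamma> d'"
    by (intro lower_cone_mono; simp)+
  \<comment> \<open>On this open set \<open>w\<close> is the \<mu>-inverse, hence also the
    \<nu>-inverse, of its image \<open>z\<close> under the Cauchy transform of \<mu>, so both
    transforms send \<open>w\<close> to \<open>z\<close>.\<close>
  define S where "S = upper_cone \<alpha> \<beta> \<inter> cauchy_transform \<mu> -` lower_cone \<gamma> ?e"
  show ?thesis
  proof (rule cauchy_transform_unique_open[OF \<mu> \<nu>])
    show "open S" unfolding S_def
      by (intro continuous_open_preimage open_upper_cone open_lower_cone
          continuous_on_subset[OF \<mu>.continuous_on_cauchy_transform] upper_cone_subset)
    show "S \<subseteq> upper_half_plane" using upper_cone_subset by (auto simp: S_def)
    obtain z where "z \<in> lower_cone \<gamma> ?e" using lower_cone_nonempty[OF pos(1) e] by blast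
    then have "cauchy_inverse \<mu> z \<in> S"
      using \<mu>.cauchy_inverse_works[OF p] sub by (auto simp: S_def)
    then show "S \<noteq> {}" by blast
    fix w assume "w \<in> S"
    then have w: "w \<in> upper_cone \<alpha> \<beta>" and z: "cauchy_transform \<mu> w \<in> lower_cone \<gamma> ?e"
      by (auto simp: S_def)
    let ?z = "cauchy_transform \<mu> w"
    note z' = subsetD[OF sub(1) z] subsetD[OF sub(2) z] subsetD[OF sub(3) z]
    have "w = cauchy_inverse \<mu> ?z"
      by (rule \<mu>.cauchy_inverse_eqI[OF p z'(2) w refl, symmetric])
    also have "\<dots> = cauchy_inverse \<nu> ?z"
      by (rule eq[OF z'(1), unfolded R_transform_eq_iff])
    finally have "cauchy_transform \<nu> w = cauchy_transform \<nu> (cauchy_inverse \<nu> ?z)"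
      by (rule arg_cong)
    then show "?z = cauchy_transform \<nu> w"
      using \<nu>.cauchy_inverse_works(2)[OF p' z'(3)] by simp
  qed
qed

section \<open>Poisson formula in the half-plane\<close>

text \<open>Apply Cauchy's theorem on the boundary of a large half disc to \<open>(F \<zeta> - F z) / (\<zeta> - z)\<close> times
  \<open>(z - cnj z) / (\<zeta> - cnj z)\<close>, which has only a removable singularity in the upper half-plane.\<close>

lemma poisson_formula:
  assumes e: "0 < e" and hol: "F holomorphic_on {z. - e < Im z}"
    and bdd: "\<And>z. 0 \<le> Im z \<Longrightarrow> norm (F z) \<le> C" and z: "0 < Im z"
  shows "integrable lborel (\<lambda>x. F (of_real x) * of_real (poisson_kernel (Im z) (x - Re z)))" (is ?int)
    and "(\<integral>x. F (of_real x) * of_real (poisson_kernel (Im z) (x - Re z)) \<partial>lborel) = of_real pi * F z"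
proof -
  \<comment> \<open>Reaches below the real axis, where \<open>F\<close> is still holomorphic, but
    stays above \<open>cnj z\<close>, the pole of the second factor of \<open>k\<close>.\<close>
  define S where "S = {w. - min e (Im z) < Im w}"
  have S: "open S" "convex S"
    unfolding S_def by (simp_all only: open_halfspace_Im_gt convex_halfspace_Im_gt)
  have holS: "F holomorphic_on S" by (rule holomorphic_on_subset[OF hol]) (auto simp: S_def)
  define k where "k = (\<lambda>w. (if w = z then deriv F z else (F w - F z) / (w - z)) * ((z - cnj z) / (w - cnj z)))"
  have holk: "k holomorphic_on S"
    unfolding k_def using z
    by (intro holomorphic_on_mult pole_lemma_open holS S holomorphic_intros) (auto simp: S_def complex_eq_iff)
  let ?P = "\<lambda>x. poisson_kernel (Im z) (x - Re z)"
  \<comment> \<open>On the real line \<open>(z - cnj z) / ((x - z) * (x - cnj z))\<close> is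
    \<open>2 * \<i>\<close> times the Poisson kernel.\<close>
  have k_real: "k (of_real x) = (2 * \<i>) * ((F (of_real x) - F z) * of_real (?P x))" for x
  proof -
    have "(of_real x - z) * (of_real x - cnj z) = of_real ((x - Re z)\<^sup>2 + (Im z)\<^sup>2)"
      by (auto simp: complex_eq_iff power2_eq_square algebra_simps)
    moreover have "z - cnj z = 2 * \<i> * of_real (Im z)" by (simp add: complex_eq_iff)
    ultimately show ?thesis
      using neq_of_real[OF z, of x] by (simp add: k_def poisson_kernel_def)
  qed
  have C: "0 \<le> C" using bdd[of z] z by (smt (verit) norm_ge_zero)
  \<comment> \<open>On the arc both denominators are at least \<open>R - norm z\<close> and the
    numerators at most \<open>2 * C\<close> and \<open>2 * Im z\<close>. The arc has length
    \<open>R * pi\<close>, so the integral over the diameter decays like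
    \<open>1 / R\<close>.\<close>
  have bound: "norm (integral {-R..R} (\<lambda>x. k (of_real x))) \<le> 4 * C * Im z / (R - norm z)\<^sup>2 * R * pi"
    if R: "norm z < R" for R
  proof -
    have R0: "0 < R" using R by (smt (verit) norm_ge_zero)
    let ?l = "linepath (of_real (-R)) (of_real R)" and ?c = "part_circlepath 0 R 0 pi"
    have Imc: "0 \<le> Im w" if "w \<in> path_image ?c" for w
      using that R0 by (auto simp: path_image_part_circlepath' closed_segment_eq_real_ivl
          intro!: mult_nonneg_nonneg sin_ge_zero)
    have "min e (Im z) > 0" using e z by simp
    then have cS: "path_image ?c \<subseteq> S" using Imc by (force simp: S_def)
    have lS: "path_image ?l \<subseteq> S"
    proof -
      have "of_real (-R) \<in> S" "of_real R \<in> S" using e z by (auto simp: S_def)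
      then show ?thesis using S(2) by (simp add: closed_segment_subset)
    qed
    have contk: "continuous_on S k" using holk by (rule holomorphic_on_imp_continuous_on)
    have "k contour_integrable_on ?l" "k contour_integrable_on ?c"
      using lS cS contk
      by (auto intro!: contour_integrable_continuous_linepath contour_integrable_continuous_part_circlepath
          elim: continuous_on_subset)
    then have hl: "(k has_contour_integral contour_integral ?l k) ?l"
      and hc: "(k has_contour_integral contour_integral ?c k) ?c"
      by (auto intro: has_contour_integral_integral)
    have "(k has_contour_integral contour_integral ?l k + contour_integral ?c k) (?l +++ ?c)"
      by (rule has_contour_integral_join[OF hl hc]) auto
    moreover have "(k has_contour_integral 0) (?l +++ ?c)"
    proof (rule Cauchy_theorem_convex_simple[OF holk S(2)])
      show "valid_path (?l +++ ?c)" by (intro valid_path_join) auto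
      show "path_image (?l +++ ?c) \<subseteq> S"
        using path_image_join_subset[of ?l ?c] lS cS by blast
    qed auto
    ultimately have "contour_integral ?l k = - contour_integral ?c k"
      by (metis has_contour_integral_unique eq_neg_iff_add_eq_0)
    moreover have "contour_integral ?l k = integral {-R..R} (\<lambda>x. k (of_real x))"
      using R0 by (subst contour_integral_linepath_Reals_eq) auto
    moreover have "norm (contour_integral ?c k) \<le> 4 * C * Im z / (R - norm z)\<^sup>2 * R * (pi - 0)"
    proof (rule has_contour_integral_bound_part_circlepath[OF hc])
      show "0 \<le> 4 * C * Im z / (R - norm z)\<^sup>2" using C z by simp
      fix w assume w: "w \<in> path_image ?c"
      have nw: "norm w = R" using in_path_image_part_circlepath[OF w] R0 by simp
      then have wz: "w \<noteq> z" using R by auto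
      have d: "R - norm z \<le> norm (w - z)" "R - norm z \<le> norm (w - cnj z)"
        using norm_triangle_ineq2[of w z] norm_triangle_ineq2[of w "cnj z"] nw by auto
      have "norm (z - cnj z) = 2 * Im z" using z by (simp add: complex_diff_cnj norm_mult)
      moreover have "norm (F w - F z) \<le> 2 * C"
        using bdd[OF Imc[OF w]] bdd[of z] z norm_triangle_ineq4[of "F w" "F z"] by simp
      ultimately have "norm (k w) \<le> (2 * C) * (2 * Im z) / (norm (w - z) * norm (w - cnj z))"
        using wz z unfolding k_def
        by (simp add: norm_mult norm_divide divide_right_mono mult_right_mono)
      also have "\<dots> \<le> (2 * C) * (2 * Im z) / (R - norm z)\<^sup>2"
        unfolding power2_eq_square using d R C z
        by (intro divide_left_mono mult_mono mult_pos_pos) auto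
      finally show "norm (k w) \<le> 4 * C * Im z / (R - norm z)\<^sup>2" by simp
    qed (use R0 in auto)
    ultimately show ?thesis by (metis diff_zero norm_minus_cancel)
  qed
  have contF: "continuous_on UNIV (\<lambda>x::real. F (of_real x))"
    by (rule continuous_on_compose2[OF holomorphic_on_imp_continuous_on[OF hol]])
      (use e in \<open>auto intro!: continuous_intros\<close>)
  then have meas: "(\<lambda>x. F (of_real x)) \<in> borel_measurable borel"
    by (rule borel_measurable_continuous_onI)
  have bddR: "norm (F (of_real x)) \<le> C" for x by (rule bdd) simp
  show int: ?int
  proof (rule Bochner_Integration.integrable_bound)
    show "integrable lborel (\<lambda>x. C * ?P x)"
      using integrable_poisson_kernel[OF z] by (rule integrable_mult_right)
    show "AE x in lborel. norm (F (of_real x) * of_real (?P x)) \<le> norm (C * ?P x)"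
      using bddR C poisson_kernel_nonneg[OF z] by (auto simp: norm_mult abs_mult intro!: mult_right_mono)
  qed (use meas in measurable)
  have int': "integrable lborel (\<lambda>x. F z * of_real (?P x))"
    using integrable_poisson_kernel[OF z] by (intro integrable_mult_right integrable_of_real)
  have eqk: "k (of_real x) = (2 * \<i>) * (F (of_real x) * of_real (?P x) - F z * of_real (?P x))" for x
    unfolding k_real by (simp add: algebra_simps)
  have intk: "integrable lborel (\<lambda>x. k (of_real x))"
    unfolding eqk by (intro integrable_mult_right Bochner_Integration.integrable_diff int int')
  have lim: "(\<lambda>n. LINT x:{- real n..real n}|lborel. k (of_real x)) \<longlonglongrightarrow> (\<integral>x. k (of_real x) \<partial>lborel)"
    unfolding set_lebesgue_integral_def
  proof (rule integral_dominated_convergence[where w="\<lambda>x. norm (k (of_real x))"])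
    show "AE x in lborel. (\<lambda>n. indicat_real {- real n..real n} x *\<^sub>R k (of_real x)) \<longlonglongrightarrow> k (of_real x)"
    proof (rule AE_I2, rule tendsto_eventually)
      fix x :: real
      show "\<forall>\<^sub>F n in sequentially. indicat_real {- real n..real n} x *\<^sub>R k (of_real x) = k (of_real x)"
        using eventually_ge_at_top[of "nat \<lceil>\<bar>x\<bar>\<rceil>"]
      proof eventually_elim
        case (elim n)
        then have "\<bar>x\<bar> \<le> real n" by linarith
        then have "x \<in> {- real n..real n}" by (simp add: abs_le_iff)
        then show ?case by simp
      qed
    qed
    show "(\<lambda>x. k (of_real x)) \<in> borel_measurable lborel" using intk by auto
    then show "(\<lambda>x. indicat_real {- real n..real n} x *\<^sub>R k (of_real x)) \<in> borel_measurable lborel" for n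
      by measurable
    show "integrable lborel (\<lambda>x. norm (k (of_real x)))" using intk by (rule integrable_norm)
  qed (auto split: split_indicator)
  have "(\<lambda>n. LINT x:{- real n..real n}|lborel. k (of_real x)) \<longlonglongrightarrow> 0"
  proof (rule Lim_transform_bound)
    show "\<forall>\<^sub>F n in sequentially. norm (LINT x:{- real n..real n}|lborel. k (of_real x))
      \<le> norm (4 * C * Im z / (real n - norm z)\<^sup>2 * real n * pi)"
      using eventually_gt_at_top[of "nat \<lceil>norm z\<rceil>"]
    proof eventually_elim
      case (elim n)
      then have n: "norm z < real n" by linarith
      have "set_integrable lborel {- real n..real n} (\<lambda>x. k (of_real x))"
        unfolding set_integrable_def using intk by (intro integrable_mult_indicator) auto
      then have "(LINT x:{- real n..real n}|lborel. k (of_real x)) = integral {- real n..real n} (\<lambda>x. k (of_real x))"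
        by (rule set_borel_integral_eq_integral)
      then show ?case using bound[OF n] by (smt (verit) real_norm_def)
    qed
    show "(\<lambda>n. 4 * C * Im z / (real n - norm z)\<^sup>2 * real n * pi) \<longlonglongrightarrow> 0"
      by real_asymp
  qed
  with lim have "(\<integral>x. k (of_real x) \<partial>lborel) = 0" by (rule LIMSEQ_unique)
  then have "(\<integral>x. F (of_real x) * of_real (?P x) - F z * of_real (?P x) \<partial>lborel) = 0"
    unfolding eqk by (subst (asm) integral_mult_right_zero) simp
  then have "(\<integral>x. F (of_real x) * of_real (?P x) \<partial>lborel) = (\<integral>x. F z * of_real (?P x) \<partial>lborel)"
    by (subst (asm) Bochner_Integration.integral_diff[OF int int']) simp
  also have "\<dots> = F z * of_real pi"
    by (subst integral_mult_right_zero) (simp add: integral_complex_of_real integral_poisson_kernel[OF z])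
  finally show "(\<integral>x. F (of_real x) * of_real (?P x) \<partial>lborel) = of_real pi * F z" by simp
qed

section \<open>Recovering a measure from boundary values\<close>

lemma holomorphic_Im_eq_0_imp_constant:
  assumes hol: "h holomorphic_on S" and S: "open S" "connected S" and Im: "\<And>z. z \<in> S \<Longrightarrow> Im (h z) = 0"
  shows "h constant_on S"
proof (rule ccontr)
  assume nc: "\<not> h constant_on S"
  then obtain z where z: "z \<in> S" by (auto simp: constant_on_def)
  have "open (h ` S)" by (rule open_mapping_thm[OF hol S S(1) order_refl nc])
  then obtain e where e: "0 < e" "ball (h z) e \<subseteq> h ` S"
    using z by (meson imageI open_contains_ball)
  have "h z + \<i> * of_real (e / 2) \<in> ball (h z) e"
    using e(1) by (simp add: dist_norm norm_mult)
  then obtain w where "w \<in> S" "h w = h z + \<i> * of_real (e / 2)" using e(2) by (metis imageE subsetD)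
  then have "Im (h z + \<i> * of_real (e / 2)) = 0" using Im by metis
  then show False using Im[OF z] e(1) by simp
qed

text \<open>Stieltjes inversion read backwards: the Poisson formula identifies \<open>- Im G\<close>
  with the Poisson integral of \<open>p\<close>, the behaviour at \<open>\<i> * \<infinity>\<close>
  supplies total mass 1, and a holomorphic function is determined by its imaginary part up to a real
  constant. Convergence almost everywhere along one sequence is enough, as the boundedness of
  \<open>G\<close> allows dominated convergence.\<close>

theorem cauchy_transform_density:
  fixes p :: "real \<Rightarrow> real" and \<epsilon> :: "nat \<Rightarrow> real"
  assumes hol: "G holomorphic_on upper_half_plane"
    and bdd: "\<And>z. 0 < Im z \<Longrightarrow> norm (G z) \<le> C"
    and neg: "\<And>z. 0 < Im z \<Longrightarrow> Im (G z) \<le> 0"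
    and asymp: "((\<lambda>y. \<i> * of_real y * G (\<i> * of_real y)) \<longlongrightarrow> 1) at_top"
    and \<epsilon>: "\<And>n. 0 < \<epsilon> n" "\<epsilon> \<longlonglongrightarrow> 0"
    and p: "p \<in> borel_measurable borel" "\<And>x. 0 \<le> p x"
    and lim: "AE x in lborel. (\<lambda>n. - Im (G (Complex x (\<epsilon> n))) / pi) \<longlonglongrightarrow> p x"
  shows "real_distribution (density lborel p)"
    and "\<And>z. 0 < Im z \<Longrightarrow> cauchy_transform (density lborel p) z = G z"
proof -
  note [measurable] = p(1)
  have C: "0 \<le> C" using bdd[of \<i>] by (smt (verit) norm_ge_zero imaginary_unit.simps(2))
  have pC: "AE x in lborel. p x \<le> C / pi"
    using lim
  proof eventually_elim
    case (elim x)
    have "- Im (G (Complex x (\<epsilon> n))) / pi \<le> C / pi" for n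
      using bdd[of "Complex x (\<epsilon> n)"] \<epsilon>(1)[of n] abs_Im_le_cmod[of "G (Complex x (\<epsilon> n))"]
      by (intro divide_right_mono) auto
    with elim show ?case by (auto intro: LIMSEQ_le_const2)
  qed
  have contG: "isCont G z" if "0 < Im z" for z
    using that hol holomorphic_on_imp_continuous_on[OF hol] open_upper_half_plane
    by (metis continuous_on_eq_continuous_at mem_Collect_eq)
  \<comment> \<open>Lifting the boundary to height \<open>\<epsilon> n\<close> makes the Poisson
    formula applicable: the translated function is holomorphic slightly below the real axis and
    bounded on the closed half-plane.\<close>
  have shift: "(\<integral>x. - Im (G (Complex x (\<epsilon> n))) / pi * poisson_kernel (Im z) (x - Re z) \<partial>lborel)
      = - Im (G (z + \<i> * of_real (\<epsilon> n)))"
    and meas: "(\<lambda>x. - Im (G (Complex x (\<epsilon> n))) / pi) \<in> borel_measurable borel" if z: "0 < Im z" for n z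
  proof -
    let ?F = "\<lambda>w. G (w + \<i> * of_real (\<epsilon> n))"
    have holF: "?F holomorphic_on {w. - \<epsilon> n < Im w}"
      by (rule holomorphic_on_compose_gen[OF _ hol, unfolded o_def]) (auto intro!: holomorphic_intros)
    have bddF: "norm (?F w) \<le> C" if "0 \<le> Im w" for w
      by (rule bdd) (use that \<epsilon>(1)[of n] in auto)
    have C: "of_real x + \<i> * of_real (\<epsilon> n) = Complex x (\<epsilon> n)" for x by (simp add: complex_eq_iff)
    note P = poisson_formula[OF \<epsilon>(1) holF bddF z, unfolded C]
    have "(\<integral>x. Im (G (Complex x (\<epsilon> n)) * of_real (poisson_kernel (Im z) (x - Re z))) \<partial>lborel)
       = Im (of_real pi * ?F z)"
      using integral_Im[OF P(1)] P(2) by simp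
    then have "(\<integral>x. (- 1 / pi) * (Im (G (Complex x (\<epsilon> n))) * poisson_kernel (Im z) (x - Re z)) \<partial>lborel)
       = (- 1 / pi) * (pi * Im (?F z))"
      by (subst integral_mult_right_zero) simp
    then show "(\<integral>x. - Im (G (Complex x (\<epsilon> n))) / pi * poisson_kernel (Im z) (x - Re z) \<partial>lborel)
      = - Im (G (z + \<i> * of_real (\<epsilon> n)))" by simp
    have "continuous_on UNIV (\<lambda>x. ?F (of_real x))"
      by (rule continuous_on_compose2[OF holomorphic_on_imp_continuous_on[OF holF]])
        (use \<epsilon>(1)[of n] in \<open>auto intro!: continuous_intros\<close>)
    then have "continuous_on UNIV (\<lambda>x. G (Complex x (\<epsilon> n)))" by (simp add: C)
    then have "continuous_on UNIV (\<lambda>x. - Im (G (Complex x (\<epsilon> n))) / pi)"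
      by (intro continuous_intros) auto
    then show "(\<lambda>x. - Im (G (Complex x (\<epsilon> n))) / pi) \<in> borel_measurable borel"
      by (rule borel_measurable_continuous_onI)
  qed
  have Im_G: "(\<integral>x. p x * poisson_kernel (Im z) (x - Re z) \<partial>lborel) = - Im (G z)"
    and int_pP: "integrable lborel (\<lambda>x. p x * poisson_kernel (Im z) (x - Re z))" if z: "0 < Im z" for z
  proof -
    let ?P = "\<lambda>x. poisson_kernel (Im z) (x - Re z)"
    have iP: "integrable lborel (\<lambda>x. C / pi * ?P x)"
      using integrable_poisson_kernel[OF z] by (rule integrable_mult_right)
    have "(\<lambda>n. \<integral>x. - Im (G (Complex x (\<epsilon> n))) / pi * ?P x \<partial>lborel) \<longlonglongrightarrow> (\<integral>x. p x * ?P x \<partial>lborel)"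
    proof (rule integral_dominated_convergence[OF _ _ iP])
      show "AE x in lborel. (\<lambda>n. - Im (G (Complex x (\<epsilon> n))) / pi * ?P x) \<longlonglongrightarrow> p x * ?P x"
        using lim by eventually_elim (rule tendsto_mult_right)
      show "AE x in lborel. norm (- Im (G (Complex x (\<epsilon> n))) / pi * ?P x) \<le> C / pi * ?P x" for n
      proof (rule AE_I2)
        fix x
        have "\<bar>Im (G (Complex x (\<epsilon> n)))\<bar> \<le> C"
          using bdd[of "Complex x (\<epsilon> n)"] \<epsilon>(1)[of n] abs_Im_le_cmod[of "G (Complex x (\<epsilon> n))"] by auto
        then show "norm (- Im (G (Complex x (\<epsilon> n))) / pi * ?P x) \<le> C / pi * ?P x"
          using poisson_kernel_nonneg[OF z, of "x - Re z"]
          by (auto simp: abs_mult intro!: mult_right_mono divide_right_mono)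
      qed
    qed (use meas[OF z] in measurable)
    moreover have "(\<lambda>n. - Im (G (z + \<i> * of_real (\<epsilon> n)))) \<longlonglongrightarrow> - Im (G z)"
    proof -
      have "(\<lambda>n. z + \<i> * of_real (\<epsilon> n)) \<longlonglongrightarrow> z + \<i> * of_real 0"
        by (intro tendsto_intros \<epsilon>(2))
      then have "(\<lambda>n. z + \<i> * of_real (\<epsilon> n)) \<longlonglongrightarrow> z" by simp
      then have "(\<lambda>n. G (z + \<i> * of_real (\<epsilon> n))) \<longlonglongrightarrow> G z"
        by (rule isCont_tendsto_compose[OF contG[OF z]])
      then show ?thesis by (intro tendsto_intros)
    qed
    ultimately show "(\<integral>x. p x * ?P x \<partial>lborel) = - Im (G z)"
      unfolding shift[OF z] by (rule LIMSEQ_unique)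
    show "integrable lborel (\<lambda>x. p x * ?P x)"
    proof (rule Bochner_Integration.integrable_bound[OF iP])
      show "AE x in lborel. norm (p x * ?P x) \<le> norm (C / pi * ?P x)"
        using pC
      proof eventually_elim
        case (elim x)
        then show ?case
          using p(2) C mult_right_mono[OF elim poisson_kernel_nonneg[OF z, of "x - Re z"]]
            poisson_kernel_nonneg[OF z, of "x - Re z"] by (simp add: abs_mult)
      qed
    qed measurable
  qed
  let ?y = "\<lambda>n. real (Suc n)"
  have y_top: "filterlim ?y at_top sequentially"
    by (rule filterlim_compose[OF filterlim_real_sequentially filterlim_Suc])
  \<comment> \<open>At \<open>z = \<i> * y\<close> the Poisson integral times \<open>y\<close> is
    the integral of \<open>p x / (1 + (x / y)^2)\<close>, which increases to the integral of
    \<open>p\<close> as \<open>y\<close> grows; its limit is 1 by \<open>asymp\<close>.\<close>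
  have mass: "integrable lborel p" "integral\<^sup>L lborel p = 1"
  proof -
    let ?f = "\<lambda>n x. ?y n * (p x * poisson_kernel (?y n) x)"
    have f: "?f n x = p x * (1 / (1 + (x / ?y n)\<^sup>2))" for n x
      by (simp add: poisson_kernel_def divide_simps power2_eq_square)
    have int: "integrable lborel (\<lambda>x. p x * poisson_kernel (?y n) x)"
      and eq: "(\<integral>x. p x * poisson_kernel (?y n) x \<partial>lborel) = - Im (G (\<i> * of_real (?y n)))" for n
      using int_pP[of "\<i> * of_real (?y n)"] Im_G[of "\<i> * of_real (?y n)"] by (simp_all del: of_nat_Suc)
    have i: "integrable lborel (?f n)" for n using int by (rule integrable_mult_right)
    have "(\<lambda>n. Re (\<i> * of_real (?y n) * G (\<i> * of_real (?y n)))) \<longlonglongrightarrow> Re 1"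
      by (intro tendsto_Re filterlim_compose[OF asymp y_top])
    moreover have "Re (\<i> * of_real (?y n) * G (\<i> * of_real (?y n))) = integral\<^sup>L lborel (?f n)" for n
      by (subst integral_mult_right_zero) (simp add: eq del: of_nat_Suc)
    ultimately have l: "(\<lambda>n. integral\<^sup>L lborel (?f n)) \<longlonglongrightarrow> 1" by simp
    have m: "AE x in lborel. mono (\<lambda>n. ?f n x)"
      unfolding f
    proof (intro AE_I2 monoI mult_left_mono p divide_left_mono add_left_mono)
      fix x and m n :: nat assume "m \<le> n"
      then have "\<bar>x / ?y n\<bar> \<le> \<bar>x / ?y m\<bar>" by (simp add: divide_left_mono)
      then show "(x / ?y n)\<^sup>2 \<le> (x / ?y m)\<^sup>2" by (simp only: abs_le_square_iff)
    qed (auto intro!: mult_pos_pos add_pos_nonneg)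
    have t: "AE x in lborel. (\<lambda>n. ?f n x) \<longlonglongrightarrow> p x"
    proof (rule AE_I2)
      fix x
      have "(\<lambda>n. x / ?y n) \<longlonglongrightarrow> 0"
        using LIMSEQ_Suc[OF lim_const_over_n[of x]] by simp
      then have "(\<lambda>n. p x * (1 / (1 + (x / ?y n)\<^sup>2))) \<longlonglongrightarrow> p x * (1 / (1 + 0\<^sup>2))"
        by (intro tendsto_intros) auto
      then show "(\<lambda>n. ?f n x) \<longlonglongrightarrow> p x" unfolding f by simp
    qed
    have nn: "AE x in lborel. 0 \<le> ?f n x" for n
      unfolding f using p by (auto intro!: mult_nonneg_nonneg)
    have pb: "p \<in> borel_measurable lborel" by simp
    show "integrable lborel p" "integral\<^sup>L lborel p = 1"
      using integral_monotone_convergence_nonneg[OF i m nn t l pb] by auto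
  qed
  let ?\<rho> = "density lborel p"
  show \<rho>: "real_distribution ?\<rho>"
  proof -
    have "emeasure ?\<rho> (space ?\<rho>) = (\<integral>\<^sup>+x. p x \<partial>lborel)"
      by (subst emeasure_density) auto
    also have "\<dots> = 1"
      using nn_integral_eq_integral[OF mass(1)] mass(2) p(2) by simp
    finally show ?thesis
      by (auto simp: real_distribution_def real_distribution_axioms_def intro!: prob_spaceI)
  qed
  interpret \<rho>: real_distribution ?\<rho> by (rule \<rho>)
  \<comment> \<open>Both terms have the same imaginary part, so the difference is constant; both
    tend to 0 along the imaginary axis, so the constant is 0.\<close>
  let ?h = "\<lambda>z. cauchy_transform ?\<rho> z - G z"
  have "?h constant_on upper_half_plane"
  proof (rule holomorphic_Im_eq_0_imp_constant[OF _ open_upper_half_plane connected_upper_half_plane])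
    show "?h holomorphic_on upper_half_plane"
      by (intro holomorphic_intros \<rho>.holomorphic_cauchy_transform hol)
    fix z assume "z \<in> upper_half_plane"
    then have z: "0 < Im z" by simp
    have "Im (cauchy_transform ?\<rho> z) = - (\<integral>s. poisson_kernel (Im z) (Re z - s) \<partial>?\<rho>)"
      using \<rho>.Im_cauchy_transform_poisson[OF z, of "Re z"] by simp
    also have "(\<integral>s. poisson_kernel (Im z) (Re z - s) \<partial>?\<rho>) = (\<integral>s. p s * poisson_kernel (Im z) (s - Re z) \<partial>lborel)"
      using p by (subst integral_density) (auto simp: poisson_kernel_def power2_commute)
    finally show "Im (?h z) = 0" using Im_G[OF z] by simp
  qed
  then obtain c where c: "?h z = c" if "0 < Im z" for z
    by (auto simp: constant_on_def)
  have "(\<lambda>n. ?h (\<i> * of_real (?y n))) \<longlonglongrightarrow> 0 - 0"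
  proof (rule tendsto_diff)
    have y0: "(\<lambda>n. 1 / ?y n) \<longlonglongrightarrow> 0"
      using LIMSEQ_Suc[OF lim_const_over_n[of "1::real"]] by simp
    show "(\<lambda>n. cauchy_transform ?\<rho> (\<i> * of_real (?y n))) \<longlonglongrightarrow> 0"
    proof (rule Lim_transform_bound[OF _ y0])
      show "\<forall>\<^sub>F n in sequentially. norm (cauchy_transform ?\<rho> (\<i> * of_real (?y n))) \<le> norm (1 / ?y n)"
        using \<rho>.norm_cauchy_transform_le[of "\<i> * of_real (?y n)" for n] by (intro always_eventually) simp
    qed
    have "(\<lambda>n. (\<i> * of_real (?y n) * G (\<i> * of_real (?y n))) * (of_real (1 / ?y n) / \<i>)) \<longlonglongrightarrow> 1 * (of_real 0 / \<i>)"
      by (intro tendsto_mult tendsto_divide tendsto_of_real y0 tendsto_const filterlim_compose[OF asymp y_top]) auto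
    moreover have "(\<i> * of_real (?y n) * G (\<i> * of_real (?y n))) * (of_real (1 / ?y n) / \<i>)
      = G (\<i> * of_real (?y n))" for n
      by (simp add: field_simps del: of_nat_Suc)
    ultimately show "(\<lambda>n. G (\<i> * of_real (?y n))) \<longlonglongrightarrow> 0"
      by (simp only:) simp
  qed
  moreover have "?h (\<i> * of_real (?y n)) = c" for n
    by (rule c) (simp del: of_nat_Suc)
  ultimately have "c = 0" by (simp add: LIMSEQ_const_iff)
  then show "cauchy_transform ?\<rho> z = G z" if "0 < Im z" for z
    using c[OF that] by simp
qed

section \<open>Subordination\<close>

context real_distribution
begin

definition subord_map :: "real \<Rightarrow> complex \<Rightarrow> complex" where
  "subord_map t w = w + of_real t * cauchy_transform M w"

definition subord_domain :: "real \<Rightarrow> complex set" where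
  "subord_domain t = {w. 0 < Im w \<and> t * resolvent_energy w < 1}"

text \<open>This is \<open>F\<close> of the overview, the inverse of \<open>H\<close>, written
  \<open>subord_map\<close>. Its values are meaningful on the upper half-plane, which turns out to
  be the image of the domain; elsewhere they are unspecified.\<close>

definition subord :: "real \<Rightarrow> complex \<Rightarrow> complex" where
  "subord t = inv_into (subord_domain t) (subord_map t)"

lemma subord_domain_subset: "subord_domain t \<subseteq> upper_half_plane"
  by (auto simp: subord_domain_def)

lemma Im_subord_map: "0 < Im w \<Longrightarrow> Im (subord_map t w) = Im w * (1 - t * resolvent_energy w)"
  by (simp add: subord_map_def Im_cauchy_transform algebra_simps)

lemma subord_domain_iff: "0 < Im w \<Longrightarrow> w \<in> subord_domain t \<longleftrightarrow> 0 < Im (subord_map t w)"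
  by (simp add: subord_domain_def Im_subord_map zero_less_mult_iff)

lemma holomorphic_subord_map: "subord_map t holomorphic_on upper_half_plane"
  unfolding subord_map_def by (intro holomorphic_intros holomorphic_cauchy_transform)

lemma continuous_on_subord_map: "continuous_on upper_half_plane (subord_map t)"
  by (rule holomorphic_on_imp_continuous_on[OF holomorphic_subord_map])

lemma open_subord_domain: "open (subord_domain t)"
proof -
  have "subord_domain t = upper_half_plane \<inter> subord_map t -` upper_half_plane"
    using subord_domain_iff subord_domain_subset by auto
  then show ?thesis
    using continuous_open_preimage[OF continuous_on_subord_map open_upper_half_plane open_upper_half_plane]
    by simp
qed

text \<open>Here \<open>q\<close> is 1 minus \<open>t\<close> times the integral of
  \<open>1 / ((w - x) * (w' - x))\<close>, and the norm of that integral is at most the mean of two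
  energies below \<open>1 / t\<close>. The sign of \<open>Re q\<close> gives more than injectivity:
  it also orders the real parts of \<open>F\<close> along horizontal lines.\<close>

lemma subord_map_diff:
  assumes t: "0 < t" and w: "w \<in> subord_domain t" "w' \<in> subord_domain t"
  obtains q where "subord_map t w - subord_map t w' = (w - w') * q" "0 < Re q"
proof -
  have Im: "0 < Im w" "0 < Im w'" and J: "t * resolvent_energy w < 1" "t * resolvent_energy w' < 1"
    using w by (auto simp: subord_domain_def)
  let ?D = "\<integral>x. 1 / ((w - of_real x) * (w' - of_real x)) \<partial>M"
  have eq: "subord_map t w - subord_map t w' = (w - w') * (1 - of_real t * ?D)"
  proof -
    have "subord_map t w - subord_map t w' = (w - w') + of_real t * (cauchy_transform M w - cauchy_transform M w')"
      by (simp add: subord_map_def algebra_simps)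
    also have "\<dots> = (w - w') * (1 - of_real t * ?D)"
      unfolding cauchy_transform_diff[OF Im] by (simp add: algebra_simps)
    finally show ?thesis .
  qed
  have "Re (of_real t * ?D) \<le> t * norm ?D"
    using t complex_Re_le_cmod[of "of_real t * ?D"] by (simp add: norm_mult)
  also have "\<dots> \<le> t * ((resolvent_energy w + resolvent_energy w') / 2)"
    using t norm_integral_resolvent_mult_le[OF Im] by (intro mult_left_mono) auto
  also have "\<dots> < 1" using J by (simp add: algebra_simps)
  finally have "0 < Re (1 - of_real t * ?D)" by simp
  with eq show thesis by (rule that)
qed

lemma inj_on_subord_map: "0 < t \<Longrightarrow> inj_on (subord_map t) (subord_domain t)"
proof (rule inj_onI)
  fix w w' assume t: "0 < t" and w: "w \<in> subord_domain t" "w' \<in> subord_domain t"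
    and eq: "subord_map t w = subord_map t w'"
  obtain q where "subord_map t w - subord_map t w' = (w - w') * q" "0 < Re q"
    by (rule subord_map_diff[OF t w])
  with eq show "w = w'" by auto
qed

text \<open>Unlike \<open>1 / Im w\<close>, this bound persists down to the real axis.\<close>

lemma norm_cauchy_transform_subord_domain_le:
  assumes t: "0 < t" and w: "w \<in> subord_domain t"
  shows "norm (cauchy_transform M w) \<le> sqrt (1 / t)"
proof (rule real_le_rsqrt)
  have "resolvent_energy w < 1 / t"
    using w t by (simp add: subord_domain_def field_simps)
  then show "(norm (cauchy_transform M w))\<^sup>2 \<le> 1 / t"
    using norm_cauchy_transform_le_energy[of w] w by (simp add: subord_domain_def)
qed

lemma Im_subord_map_le:
  assumes "0 < t" "0 < Im w"
  shows "Im (subord_map t w) \<le> Im w"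
  using assms resolvent_energy_pos[OF assms(2)] by (simp add: Im_subord_map mult_le_cancel_left1)

lemma subord_domain_nonempty:
  assumes t: "0 < t"
  shows "subord_domain t \<noteq> {}"
proof -
  \<comment> \<open>Any height above \<open>sqrt t\<close> would do: there the energy is at most
    \<open>1 / (Im w)^2\<close>, which is below \<open>1 / t\<close>.\<close>
  let ?w = "\<i> * of_real (sqrt t + 1)"
  have p: "0 < Im ?w" using t by (simp add: add_pos_nonneg)
  have "Im ?w * resolvent_energy ?w \<le> 1 / Im ?w"
    using norm_cauchy_transform_le[OF p] abs_Im_le_cmod[of "cauchy_transform M ?w"]
      resolvent_energy_pos[OF p] p unfolding Im_cauchy_transform[OF p] by (simp only: abs_mult abs_minus_cancel)
  moreover have "J \<le> 1 / s\<^sup>2" if "s * J \<le> 1 / s" "0 < s" for s J :: real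
    using that by (simp add: field_simps power2_eq_square)
  ultimately have "resolvent_energy ?w \<le> 1 / (Im ?w)\<^sup>2"
    using p by blast
  then have "t * resolvent_energy ?w \<le> t * (1 / (Im ?w)\<^sup>2)"
    using t by (intro mult_left_mono) auto
  also have "t < (Im ?w)\<^sup>2"
    using t by (simp add: power2_eq_square algebra_simps add_pos_nonneg)
  then have "t * (1 / (Im ?w)\<^sup>2) < 1" using p by (simp add: field_simps)
  finally have "?w \<in> subord_domain t" using p by (simp add: subord_domain_def)
  then show ?thesis by blast
qed

text \<open>The image is open and relatively closed in the connected half-plane. For closedness,
  preimages of a convergent sequence stay bounded because \<open>G\<close> is bounded on the domain,
  and their limit stays off the real axis because \<open>H\<close> never increases the imaginary
  part.\<close>

lemma subord_map_image:
  assumes t: "0 < t"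
  shows "subord_map t ` subord_domain t = upper_half_plane"
proof -
  let ?I = "subord_map t ` subord_domain t"
  have sub: "?I \<subseteq> upper_half_plane"
    using subord_domain_iff subord_domain_subset by blast
  have "open ?I"
    by (rule open_mapping_thm3[OF holomorphic_on_subset[OF holomorphic_subord_map subord_domain_subset]
        open_subord_domain inj_on_subord_map[OF t]])
  then have "openin (top_of_set upper_half_plane) ?I"
    using sub by (simp add: openin_open_eq open_upper_half_plane)
  moreover have "closedin (top_of_set upper_half_plane) ?I"
    unfolding closedin_limpt
  proof (intro conjI sub allI impI)
    fix z assume "z islimpt ?I \<and> z \<in> upper_half_plane"
    then obtain f where f: "\<And>n. f n \<in> ?I" "f \<longlonglongrightarrow> z" and z: "0 < Im z"
      by (auto simp: islimpt_sequential)
    from f(1) have "\<forall>n. \<exists>w. w \<in> subord_domain t \<and> subord_map t w = f n" by (metis imageE)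
    then obtain w where w: "\<And>n. w n \<in> subord_domain t" "\<And>n. subord_map t (w n) = f n" by metis
    have w_eq: "w n = f n - of_real t * cauchy_transform M (w n)" for n
      using w(2)[of n] by (simp add: subord_map_def algebra_simps)
    obtain B where B: "\<And>n. norm (f n) \<le> B"
      using f(2) convergent_imp_bounded by (metis bounded_iff rangeI)
    have "norm (w n) \<le> B + t * sqrt (1 / t)" for n
    proof -
      have "norm (w n) \<le> norm (f n) + norm (of_real t * cauchy_transform M (w n))"
        by (subst w_eq) (rule norm_triangle_ineq4)
      also have "\<dots> \<le> B + t * sqrt (1 / t)"
        using B norm_cauchy_transform_subord_domain_le[OF t w(1)] t by (auto simp: norm_mult intro!: add_mono mult_left_mono)
      finally show ?thesis .
    qed
    then have "bounded (range w)" by (auto simp: bounded_iff)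
    then obtain l r where r: "strict_mono r" "(w \<circ> r) \<longlonglongrightarrow> l"
      using bounded_imp_convergent_subsequence by blast
    have fr: "(f \<circ> r) \<longlonglongrightarrow> z" by (rule LIMSEQ_subseq_LIMSEQ[OF f(2) r(1)])
    have "Im z \<le> Im l"
    proof (rule LIMSEQ_le[OF tendsto_Im[OF fr] tendsto_Im[OF r(2)]])
      show "\<exists>N. \<forall>n\<ge>N. Im ((f \<circ> r) n) \<le> Im ((w \<circ> r) n)"
        using Im_subord_map_le[OF t] w subord_domain_subset by (metis comp_apply mem_Collect_eq subsetD)
    qed
    with z have l: "0 < Im l" by simp
    then have "isCont (subord_map t) l"
      using continuous_on_subord_map open_upper_half_plane
      by (metis continuous_on_eq_continuous_at mem_Collect_eq)
    from isCont_tendsto_compose[OF this r(2)] have "(f \<circ> r) \<longlonglongrightarrow> subord_map t l"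
      by (simp add: w(2) o_def)
    with fr have "subord_map t l = z" using LIMSEQ_unique by blast
    then show "z \<in> ?I" using l z subord_domain_iff by blast
  qed
  ultimately have "?I = {} \<or> ?I = upper_half_plane"
    using connected_upper_half_plane connected_clopen by blast
  then show ?thesis using subord_domain_nonempty[OF t] by simp
qed

section \<open>The subordination function for fixed positive \<open>t\<close>\<close>

context
  fixes t :: real
  assumes t: "0 < t"
begin

lemma subord_in_domain: "0 < Im z \<Longrightarrow> subord t z \<in> subord_domain t"
  using subord_map_image[OF t] inv_into_into[of z "subord_map t" "subord_domain t"]
  by (simp add: subord_def)

lemma subord_map_subord: "0 < Im z \<Longrightarrow> subord_map t (subord t z) = z"
  using subord_map_image[OF t] f_inv_into_f[of z "subord_map t" "subord_domain t"]
  by (simp add: subord_def)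

lemma subord_eqI: "0 < Im z \<Longrightarrow> w \<in> subord_domain t \<Longrightarrow> subord_map t w = z \<Longrightarrow> subord t z = w"
  using inv_into_f_f[OF inj_on_subord_map[OF t]] by (auto simp: subord_def)

lemma Im_subord_pos: "0 < Im z \<Longrightarrow> 0 < Im (subord t z)"
  using subord_in_domain subord_domain_subset by blast

lemma Im_subord_ge: "0 < Im z \<Longrightarrow> Im z \<le> Im (subord t z)"
  using Im_subord_map_le[OF t Im_subord_pos] subord_map_subord by metis

lemma subord_eq: "0 < Im z \<Longrightarrow> subord t z = z - of_real t * cauchy_transform M (subord t z)"
  using subord_map_subord[of z] by (simp add: subord_map_def algebra_simps)

lemma holomorphic_subord: "subord t holomorphic_on upper_half_plane"
proof -
  obtain g where g: "g holomorphic_on subord_map t ` subord_domain t"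
    "\<And>w. w \<in> subord_domain t \<Longrightarrow> g (subord_map t w) = w"
    using holomorphic_has_inverse[OF holomorphic_on_subset[OF holomorphic_subord_map subord_domain_subset]
      open_subord_domain inj_on_subord_map[OF t]] by metis
  from g(1) have "g holomorphic_on upper_half_plane"
    unfolding subord_map_image[OF t] .
  then show ?thesis
  proof (rule holomorphic_transform)
    show "g z = subord t z" if "z \<in> upper_half_plane" for z
      using g(2)[OF subord_in_domain[of z]] subord_map_subord[of z] that by simp
  qed
qed

lemma continuous_on_subord: "continuous_on upper_half_plane (subord t)"
  by (rule holomorphic_on_imp_continuous_on[OF holomorphic_subord])

definition subord_cauchy :: "complex \<Rightarrow> complex" where
  "subord_cauchy z = (z - subord t z) / of_real t"

lemma subord_cauchy_eq: "0 < Im z \<Longrightarrow> subord_cauchy z = cauchy_transform M (subord t z)"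
proof -
  assume "0 < Im z"
  then have "of_real t * cauchy_transform M (subord t z) = z - subord t z"
    using subord_eq[of z] by (metis add_diff_cancel_left' diff_add_cancel)
  then show ?thesis using t by (simp add: subord_cauchy_def field_simps)
qed

text \<open>For \<open>z = \<i> * y\<close> the point \<open>w = F z\<close> is within
  \<open>t / y\<close> of \<open>z\<close>. Once \<open>t / y^2 < 1\<close> it lies in the cone of
  aperture 1, where \<open>w * G w\<close> is close to 1; replacing \<open>w\<close> by
  \<open>z\<close> in front costs at most \<open>t / y^2\<close>.\<close>

lemma subord_cauchy_asymp:
  "((\<lambda>y. \<i> * of_real y * subord_cauchy (\<i> * of_real y)) \<longlongrightarrow> 1) at_top"
proof (rule tendstoI)
  fix \<epsilon> :: real assume "0 < \<epsilon>"
  then have e2: "0 < \<epsilon> / 2" by simp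
  obtain \<beta> where \<beta>: "0 < \<beta>" "cone_defect 1 \<beta> < \<epsilon> / 2"
    using cone_defect_small[OF zero_less_one e2] by metis
  have "\<forall>\<^sub>F y in at_top. t / y\<^sup>2 < min 1 (\<epsilon> / 2)"
  proof (rule order_tendstoD(2))
    show "((\<lambda>y. t / y\<^sup>2) \<longlongrightarrow> 0) at_top" by real_asymp
  qed (use e2 in simp)
  then show "\<forall>\<^sub>F y in at_top. dist (\<i> * of_real y * subord_cauchy (\<i> * of_real y)) 1 < \<epsilon>"
    using eventually_gt_at_top[of 0] eventually_gt_at_top[of \<beta>]
  proof eventually_elim
    case (elim y)
    let ?z = "\<i> * of_real y" let ?w = "subord t ?z" let ?G = "cauchy_transform M ?w"
    have z: "0 < Im ?z" using elim by simp
    note ge = Im_subord_ge[OF z] and pos = Im_subord_pos[OF z]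
    have "norm ?G \<le> 1 / Im ?w" by (rule norm_cauchy_transform_le[OF pos])
    also have "\<dots> \<le> 1 / y" using ge elim by (intro divide_left_mono) auto
    finally have G: "norm ?G \<le> 1 / y" .
    have diff: "norm (?z - ?w) \<le> t / y"
    proof -
      have "?z - ?w = of_real t * ?G" using subord_eq[OF z] by (metis add_diff_cancel_left' diff_add_cancel)
      then show ?thesis using t mult_left_mono[OF G, of t] by (simp add: norm_mult)
    qed
    have "\<bar>Re ?w\<bar> \<le> t / y" using abs_Re_le_cmod[of "?z - ?w"] diff by simp
    also have "t / y < y" using elim by (simp add: field_simps power2_eq_square)
    finally have "?w \<in> upper_cone 1 \<beta>" using ge pos elim by (simp add: upper_cone_def)
    then have "norm (?w * ?G - 1) < \<epsilon> / 2"
      using cauchy_transform_asymp[of ?w 1 \<beta>] \<beta> by simp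
    moreover have "norm ((?z - ?w) * ?G) \<le> t / y * (1 / y)"
      unfolding norm_mult using diff G elim t by (intro mult_mono) auto
    moreover have "t / y * (1 / y) = t / y\<^sup>2" by (simp add: power2_eq_square)
    ultimately have "norm ((?z - ?w) * ?G) < \<epsilon> / 2"
      using elim(1) by linarith
    note this \<open>norm (?w * ?G - 1) < \<epsilon> / 2\<close>
    moreover have "norm (?z * ?G - 1) \<le> norm ((?z - ?w) * ?G) + norm (?w * ?G - 1)"
      using norm_triangle_ineq[of "(?z - ?w) * ?G" "?w * ?G - 1"] by (simp add: algebra_simps)
    ultimately show ?case
      unfolding subord_cauchy_eq[OF z] dist_norm by linarith
  qed
qed

text \<open>At height \<epsilon> the value \<open>- Im\<close> of \<open>subord_cauchy\<close> is
  \<open>(Im F - \<epsilon>) / t\<close>, so boundary values of \<open>Im F\<close> are those of the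
  density up to the factor \<open>pi * t\<close>. The hypothesis asks for no more than a selection
  theorem can deliver.\<close>

theorem subord_density:
  fixes p :: "real \<Rightarrow> real" and \<epsilon> :: "nat \<Rightarrow> real"
  assumes \<epsilon>: "\<And>n. 0 < \<epsilon> n" "\<epsilon> \<longlonglongrightarrow> 0"
    and p: "p \<in> borel_measurable borel" "\<And>x. 0 \<le> p x"
    and lim: "AE x in lborel. (\<lambda>n. Im (subord t (Complex x (\<epsilon> n)))) \<longlonglongrightarrow> pi * t * p x"
  shows "real_distribution (density lborel p)"
    and "\<And>z. 0 < Im z \<Longrightarrow> subord t z = z - of_real t * cauchy_transform (density lborel p) z"
proof -
  have hol: "subord_cauchy holomorphic_on upper_half_plane"
    unfolding subord_cauchy_def using t by (intro holomorphic_intros holomorphic_subord) auto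
  have bdd: "norm (subord_cauchy z) \<le> sqrt (1 / t)" if "0 < Im z" for z
    unfolding subord_cauchy_eq[OF that] by (rule norm_cauchy_transform_subord_domain_le[OF t subord_in_domain[OF that]])
  have neg: "Im (subord_cauchy z) \<le> 0" if "0 < Im z" for z
    using Im_subord_ge[OF that] t by (simp add: subord_cauchy_def divide_nonpos_pos)
  have lim': "AE x in lborel. (\<lambda>n. - Im (subord_cauchy (Complex x (\<epsilon> n))) / pi) \<longlonglongrightarrow> p x"
    using lim
  proof eventually_elim
    case (elim x)
    have "(\<lambda>n. (Im (subord t (Complex x (\<epsilon> n))) - \<epsilon> n) / (pi * t)) \<longlonglongrightarrow> (pi * t * p x - 0) / (pi * t)"
      using t by (intro tendsto_intros elim \<epsilon>(2)) auto
    moreover have "(Im (subord t (Complex x (\<epsilon> n))) - \<epsilon> n) / (pi * t) =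
      - Im (subord_cauchy (Complex x (\<epsilon> n))) / pi" for n
      using t by (simp add: subord_cauchy_def field_simps)
    ultimately show ?case using t by simp
  qed
  note * = cauchy_transform_density[OF hol bdd neg subord_cauchy_asymp \<epsilon> p lim']
  show "real_distribution (density lborel p)" by (rule *(1))
  fix z :: complex assume z: "0 < Im z"
  have "cauchy_transform (density lborel p) z = subord_cauchy z"
    by (rule *(2)) (use z in auto)
  then show "subord t z = z - of_real t * cauchy_transform (density lborel p) z"
    using t by (simp add: subord_cauchy_def)
qed

text \<open>With \<open>w\<close>, \<open>w'\<close> the two values,
  \<open>x' - x = (w' - w) * q\<close> and \<open>Re q > 0\<close>; multiplying by
  \<open>cnj q\<close> shows that \<open>w' - w\<close> has positive real part.\<close>

lemma Re_subord_strict_mono: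
  assumes "0 < y" "x < x'"
  shows "Re (subord t (Complex x y)) < Re (subord t (Complex x' y))"
proof -
  let ?w = "subord t (Complex x y)" and ?w' = "subord t (Complex x' y)"
  have w: "?w' \<in> subord_domain t" "?w \<in> subord_domain t"
    using assms by (auto intro!: subord_in_domain)
  obtain q where q: "subord_map t ?w' - subord_map t ?w = (?w' - ?w) * q" "0 < Re q"
    by (rule subord_map_diff[OF t w])
  then have "of_real (x' - x) = (?w' - ?w) * q"
    using assms by (simp add: subord_map_subord complex_eq_iff)
  then have "of_real (x' - x) * cnj q = (?w' - ?w) * (q * cnj q)" by simp
  then have "of_real (x' - x) * cnj q = (?w' - ?w) * of_real ((norm q)\<^sup>2)"
    by (simp only: complex_norm_square)
  then have "Re (of_real (x' - x) * cnj q) = Re ((?w' - ?w) * of_real ((norm q)\<^sup>2))" by simp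
  then have "(x' - x) * Re q = Re (?w' - ?w) * (norm q)\<^sup>2" by simp
  moreover have "0 < (x' - x) * Re q" using assms q by simp
  ultimately have "0 < Re (?w' - ?w) * (norm q)\<^sup>2" by simp
  then show ?thesis by (simp add: zero_less_mult_iff)
qed

end

end

section \<open>Free convolution with the semicircle law\<close>

lemma mem_lower_cone_min:
  "z \<in> lower_cone \<gamma> (min \<delta> \<delta>') \<longleftrightarrow> z \<in> lower_cone \<gamma> \<delta> \<and> z \<in> lower_cone \<gamma> \<delta>'"
  by (auto simp: lower_cone_def)

section \<open>The unit mass at 0 and the semicircle law\<close>

lemma real_distribution_dirac: "real_distribution (return borel (0::real))"
proof -
  interpret prob_space "return borel (0::real)"
    by (rule prob_space_return) simp
  show ?thesis by standard simp
qed

lemma cauchy_transform_dirac: "cauchy_transform (return borel 0) z = 1 / z"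
  unfolding cauchy_transform_def by (subst integral_return) auto

lemma Im_square_root: "(Im s)\<^sup>2 = (norm (s\<^sup>2) - Re (s\<^sup>2)) / 2"
proof -
  have "norm (s\<^sup>2) = (Re s)\<^sup>2 + (Im s)\<^sup>2" by (simp only: norm_power cmod_power2)
  then show ?thesis by (simp add: power2_eq_square)
qed

text \<open>For the unit mass, \<open>w = F z\<close> solves \<open>w + t / w = z\<close>, so
  \<open>s = 2 * w - z\<close> is a square root of the discriminant \<open>z^2 - 4 * t\<close>. The
  right one is singled out by \<open>Im s > 0\<close>, which follows from
  \<open>Im w \<ge> Im z\<close>; its imaginary part is then a real square root.\<close>

lemma Im_subord_dirac:
  assumes t: "0 < t" and z: "0 < Im z"
  shows "Im (real_distribution.subord (return borel 0) t z)
    = (Im z + sqrt ((norm (z\<^sup>2 - 4 * of_real t) - Re (z\<^sup>2 - 4 * of_real t)) / 2)) / 2"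
proof -
  interpret real_distribution "return borel (0::real)" by (rule real_distribution_dirac)
  let ?w = "subord t z"
  define s where "s = 2 * ?w - z"
  have "?w + of_real t / ?w = z"
    using subord_map_subord[OF t z] by (simp add: subord_map_def cauchy_transform_dirac)
  moreover have "?w \<noteq> 0" using Im_subord_pos[OF t z] by auto
  ultimately have "?w * ?w + of_real t = z * ?w" by (auto simp: field_simps)
  moreover have "s\<^sup>2 = z\<^sup>2 - 4 * (z * ?w - ?w * ?w)"
    by (simp add: s_def power2_eq_square algebra_simps)
  ultimately have "s\<^sup>2 = z\<^sup>2 - 4 * of_real t" by (metis add_diff_cancel_left')
  then have "(Im s)\<^sup>2 = (norm (z\<^sup>2 - 4 * of_real t) - Re (z\<^sup>2 - 4 * of_real t)) / 2"
    using Im_square_root[of s] by simp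
  moreover have "0 < Im s" using Im_subord_ge[OF t z] z by (simp add: s_def)
  ultimately have "Im s = sqrt ((norm (z\<^sup>2 - 4 * of_real t) - Re (z\<^sup>2 - 4 * of_real t)) / 2)"
    by (metis less_imp_le real_sqrt_unique)
  then show ?thesis by (simp add: s_def)
qed

text \<open>An instance of \<open>subord_density\<close> for the unit mass. That the semicircle
  density has total mass 1 is part of the outcome, without integrating it.\<close>

lemma
  assumes t: "0 < t"
  shows real_distribution_semicircle: "real_distribution (semicircle t)"
    and subord_dirac_semicircle: "\<And>z. 0 < Im z \<Longrightarrow>
      real_distribution.subord (return borel 0) t z = z - of_real t * cauchy_transform (semicircle t) z"
proof -
  interpret real_distribution "return borel (0::real)" by (rule real_distribution_dirac)
  let ?p = "\<lambda>x. indicator {-2 * sqrt t .. 2 * sqrt t} x * (sqrt (4 * t - x\<^sup>2) / (2 * pi * t))"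
  let ?\<epsilon> = "\<lambda>n. 1 / real (Suc n)"
  have supp: "x \<in> {-2 * sqrt t .. 2 * sqrt t} \<longleftrightarrow> x\<^sup>2 \<le> 4 * t" for x
  proof -
    have "x\<^sup>2 \<le> 4 * t \<longleftrightarrow> sqrt (x\<^sup>2) \<le> sqrt (4 * t)" by (simp only: real_sqrt_le_iff)
    also have "\<dots> \<longleftrightarrow> x \<in> {-2 * sqrt t .. 2 * sqrt t}"
      by (auto simp: real_sqrt_mult abs_le_iff)
    finally show ?thesis by simp
  qed
  have \<epsilon>: "0 < ?\<epsilon> n" "?\<epsilon> \<longlonglongrightarrow> 0" for n
    using LIMSEQ_Suc[OF lim_const_over_n[of "1::real"]] by simp_all
  have p: "?p \<in> borel_measurable borel" "0 \<le> ?p x" for x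
    using t supp[of x] by (measurable, auto split: split_indicator)
  have "AE x in lborel. (\<lambda>n. Im (subord t (Complex x (?\<epsilon> n)))) \<longlonglongrightarrow> pi * t * ?p x"
  proof (rule AE_I2)
    fix x
    \<comment> \<open>This expression is continuous up to the real axis, where it equals
      \<open>sqrt (4 * t - x^2) / 2\<close> if \<open>x^2 \<le> 4 * t\<close> and 0
      otherwise.\<close>
    let ?g = "\<lambda>z. (Im z + sqrt ((norm (z\<^sup>2 - 4 * of_real t) - Re (z\<^sup>2 - 4 * of_real t)) / 2)) / 2"
    have "Im (subord t (Complex x (?\<epsilon> n))) = ?g (of_real x + \<i> * of_real (?\<epsilon> n))" for n
      using Im_subord_dirac[OF t, of "Complex x (?\<epsilon> n)"] by (simp add: Complex_eq del: of_nat_Suc)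
    moreover have "(\<lambda>n. ?g (of_real x + \<i> * of_real (?\<epsilon> n))) \<longlonglongrightarrow> ?g (of_real x + \<i> * of_real 0)"
      by (intro tendsto_intros \<epsilon>(2)) auto
    moreover have "?g (of_real x + \<i> * of_real 0) = pi * t * ?p x"
    proof -
      have eq: "(complex_of_real x + \<i> * of_real 0)\<^sup>2 - 4 * of_real t = of_real (x\<^sup>2 - 4 * t)" by simp
      show ?thesis
        unfolding eq norm_of_real using t supp[of x]
        by (cases "x\<^sup>2 \<le> 4 * t") (auto split: split_indicator)
    qed
    ultimately show "(\<lambda>n. Im (subord t (Complex x (?\<epsilon> n)))) \<longlonglongrightarrow> pi * t * ?p x"
      by (simp only:)
  qed
  note * = subord_density[OF t \<epsilon> p this]
  show "real_distribution (semicircle t)" unfolding semicircle_def using *(1) by simp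
  show "subord t z = z - of_real t * cauchy_transform (semicircle t) z" if "0 < Im z" for z
    unfolding semicircle_def by (rule *(2)) (use that in auto)
qed

text \<open>If \<open>w\<close> is the \<rho>-inverse of \<open>z\<close>, then
  \<open>F w = w - t * z\<close> by hypothesis, and the subordination equation gives
  \<open>G (w - t * z) = z\<close>. So the inverse for \<open>M\<close> is \<open>w - t * z\<close>,
  provided that this point still lies in a cone.\<close>

lemma (in real_distribution) R_transform_subord:
  assumes t: "0 < t" and \<rho>: "real_distribution \<rho>"
    and sub: "\<And>z. 0 < Im z \<Longrightarrow> subord t z = z - of_real t * cauchy_transform \<rho> z"
  obtains \<delta> where "0 < \<delta>"
    "\<And>z. z \<in> lower_cone 1 \<delta> \<Longrightarrow> R_transform \<rho> z = R_transform M z + of_real t * z"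
proof -
  interpret \<rho>: real_distribution \<rho> by (rule \<rho>)
  obtain \<alpha> \<beta> d where p: "inversion_params \<rho> 1 \<alpha> \<beta> d"
    using \<rho>.inversion_params_ex[of 1] by auto
  note pos = inversion_paramsD[OF p]
  have pos1: "0 < (1::real)" "0 < \<alpha> + 1" using pos by auto
  obtain d' where d': "0 < d'"
    "\<And>z w. z \<in> lower_cone 1 d' \<Longrightarrow> w \<in> upper_cone (\<alpha> + 1) \<beta> \<Longrightarrow> cauchy_transform M w = z \<Longrightarrow>
      cauchy_inverse M z = w"
    by (rule cauchy_inverse_near_0[OF pos1 pos(3)]) (rule that)
  \<comment> \<open>The bound \<open>\<beta> / t\<close> gives
    \<open>t * norm z < \<beta> < Im w\<close>, so the shift by \<open>t * z\<close> widens the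
    aperture by at most 1; the height does not drop because \<open>Im z < 0\<close>.\<close>
  let ?d = "min (min d d') (\<beta> / t)"
  show thesis
  proof (rule that[of ?d])
    show "0 < ?d" using pos d' t by simp
    fix z assume z: "z \<in> lower_cone 1 ?d"
    then have z1: "z \<in> lower_cone 1 d" and z2: "z \<in> lower_cone 1 d'" and nz: "norm z < \<beta> / t"
      and Imz: "Im z < 0"
      by (auto simp: lower_cone_def)
    let ?w = "cauchy_inverse \<rho> z"
    have G: "cauchy_transform \<rho> ?w = z" by (rule \<rho>.cauchy_inverse_works(2)[OF p z1])
    note w = upper_coneD[OF \<rho>.cauchy_inverse_works(1)[OF p z1]]
    have s: "subord t ?w = ?w - of_real t * z" using sub[of ?w] w G by simp
    have GM: "cauchy_transform M (?w - of_real t * z) = z"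
    proof -
      have "of_real t * cauchy_transform M (subord t ?w) = ?w - subord t ?w"
        using subord_eq[OF t, of ?w] w by (metis add_diff_cancel_left' diff_add_cancel)
      then show ?thesis using s t by simp
    qed
    have Im: "Im ?w \<le> Im (?w - of_real t * z)"
      using Imz t by (simp add: mult_le_0_iff)
    have "\<bar>Re (?w - of_real t * z)\<bar> \<le> \<bar>Re ?w\<bar> + t * norm z"
    proof -
      have "\<bar>t * Re z\<bar> \<le> t * norm z"
        using t abs_Re_le_cmod[of z] by (simp add: abs_mult)
      moreover have "Re (?w - of_real t * z) = Re ?w - t * Re z" by simp
      ultimately show ?thesis using abs_triangle_ineq4[of "Re ?w" "t * Re z"] by linarith
    qed
    also have "\<dots> < \<alpha> * Im ?w + Im ?w"
      using nz t w by (intro add_strict_mono) (auto simp: field_simps)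
    also have "\<dots> \<le> (\<alpha> + 1) * Im (?w - of_real t * z)"
      using mult_left_mono[OF Im, of "\<alpha> + 1"] pos by (simp add: algebra_simps)
    finally have "?w - of_real t * z \<in> upper_cone (\<alpha> + 1) \<beta>"
      using Im w by (simp add: upper_cone_def)
    from d'(2)[OF z2 this GM] show "R_transform \<rho> z = R_transform M z + of_real t * z"
      by (simp add: R_transform_def)
  qed
qed

lemma R_transform_dirac:
  obtains \<delta> where "0 < \<delta>" "\<And>z. z \<in> lower_cone 1 \<delta> \<Longrightarrow> R_transform (return borel 0) z = 0"
proof -
  interpret real_distribution "return borel (0::real)" by (rule real_distribution_dirac)
  obtain d where d: "0 < d"
    "\<And>z w. z \<in> lower_cone 1 d \<Longrightarrow> w \<in> upper_cone 1 1 \<Longrightarrow> cauchy_transform (return borel 0) w = z \<Longrightarrow>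
      cauchy_inverse (return borel 0) z = w"
    by (rule cauchy_inverse_near_0[OF zero_less_one zero_less_one zero_less_one]) (rule that)
  \<comment> \<open>In the cone \<open>norm z \<le> 2 * \<bar>Im z\<bar>\<close>, so
    \<open>norm z < 1/2\<close> yields \<open>Im (1 / z) > 1\<close>, as membership of
    \<open>1 / z\<close> in the upper cone demands.\<close>
  show thesis
  proof (rule that[of "min d (1/2)"])
    fix z assume z: "z \<in> lower_cone 1 (min d (1/2))"
    then have z1: "z \<in> lower_cone 1 d" and z': "Im z < 0" "\<bar>Re z\<bar> < \<bar>Im z\<bar>" "norm z < 1 / 2"
      by (auto simp: lower_cone_def)
    have n: "0 < norm z" using z' by auto
    have "Re (1 / z) = Re z / (norm z)\<^sup>2" and Im: "Im (1 / z) = \<bar>Im z\<bar> / (norm z)\<^sup>2"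
      using z' by (auto simp: Re_divide Im_divide cmod_power2)
    then have "\<bar>Re (1 / z)\<bar> < Im (1 / z)"
      using divide_strict_right_mono[OF z'(2), of "(norm z)\<^sup>2"] n by (simp only: abs_divide) simp
    moreover have "norm z \<le> 2 * \<bar>Im z\<bar>" using cmod_le[of z] z' by simp
    then have "norm z * norm z < \<bar>Im z\<bar>"
      using mult_strict_right_mono[OF z'(3) n] by simp
    then have "1 < Im (1 / z)" using n unfolding Im by (simp add: power2_eq_square)
    ultimately have "1 / z \<in> upper_cone 1 1" by (simp add: upper_cone_def)
    from d(2)[OF z1 this] show "R_transform (return borel 0) z = 0"
      by (simp add: R_transform_def cauchy_transform_dirac)
  qed (use d in auto)
qed

lemma R_transform_semicircle:
  assumes t: "0 < t"
  obtains \<delta> where "0 < \<delta>" "\<And>z. z \<in> lower_cone 1 \<delta> \<Longrightarrow> R_transform (semicircle t) z = of_real t * z"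
proof -
  interpret real_distribution "return borel (0::real)" by (rule real_distribution_dirac)
  obtain d where d: "0 < d" "\<And>z. z \<in> lower_cone 1 d \<Longrightarrow> R_transform (return borel 0) z = 0"
    using R_transform_dirac by blast
  obtain d' where d': "0 < d'" "\<And>z. z \<in> lower_cone 1 d' \<Longrightarrow>
      R_transform (semicircle t) z = R_transform (return borel 0) z + of_real t * z"
    using R_transform_subord[OF t real_distribution_semicircle[OF t] subord_dirac_semicircle[OF t]] by blast
  show thesis
  proof (rule that[of "min d d'"])
    show "R_transform (semicircle t) z = of_real t * z" if "z \<in> lower_cone 1 (min d d')" for z
      using that d(2)[of z] d'(2)[of z] by (simp add: mem_lower_cone_min)
  qed (use d d' in auto)
qed

text \<open>By the identity theorem on a common lower cone it suffices to know the transforms near \<open>0\<close>.\<close>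

lemma free_convolution_eqI:
  assumes \<mu>: "real_distribution \<mu>" and \<nu>: "real_distribution \<nu>" and \<rho>: "real_distribution \<rho>"
    and pos: "0 < \<gamma>" "0 < \<delta>"
    and eq: "\<And>z. z \<in> lower_cone \<gamma> \<delta> \<Longrightarrow> R_transform \<rho> z = R_transform \<mu> z + R_transform \<nu> z"
  shows "\<mu> \<boxplus> \<nu> = \<rho>"
  unfolding free_convolution_def
proof (rule the_equality, intro conjI ballI \<rho>)
  fix z assume "z \<in> R_domain \<mu> \<inter> R_domain \<nu> \<inter> R_domain \<rho>"
  then obtain \<gamma>1 \<alpha>1 \<beta>1 \<delta>1 \<gamma>2 \<alpha>2 \<beta>2 \<delta>2 \<gamma>3 \<alpha>3 \<beta>3 \<delta>3
    where p: "inversion_params \<mu> \<gamma>1 \<alpha>1 \<beta>1 \<delta>1" "inversion_params \<nu> \<gamma>2 \<alpha>2 \<beta>2 \<delta>2"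
      "inversion_params \<rho> \<gamma>3 \<alpha>3 \<beta>3 \<delta>3"
    and z: "z \<in> lower_cone \<gamma>1 \<delta>1" "z \<in> lower_cone \<gamma>2 \<delta>2" "z \<in> lower_cone \<gamma>3 \<delta>3"
    by (auto simp: R_domain_def)
  let ?L = "lower_cone \<gamma>1 \<delta>1 \<inter> lower_cone \<gamma>2 \<delta>2 \<inter> lower_cone \<gamma>3 \<delta>3"
  \<comment> \<open>Again a lower cone, hence a nonempty open part of the connected set
    \<open>?L\<close>, and the equation is known on it.\<close>
  let ?S = "lower_cone \<gamma> \<delta> \<inter> ?L"
  have L: "open ?L" "connected ?L" "?S \<noteq> {}" "open ?S"
  proof -
    show "open ?L" "open ?S" by (intro open_Int open_lower_cone)+
    show "connected ?L" unfolding lower_cone_Int by (rule connected_lower_cone)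
    show "?S \<noteq> {}" unfolding lower_cone_Int
      by (rule lower_cone_nonempty) (use pos inversion_paramsD[OF p(1)] inversion_paramsD[OF p(2)]
          inversion_paramsD[OF p(3)] in auto)
  qed
  have nz: "y \<noteq> 0" if "y \<in> ?L" for y using that by (auto simp: lower_cone_def)
  have hol: "R_transform \<mu> holomorphic_on ?L" "R_transform \<nu> holomorphic_on ?L"
    "R_transform \<rho> holomorphic_on ?L"
    unfolding R_transform_def
    using real_distribution.holomorphic_cauchy_inverse[OF \<mu> p(1)]
      real_distribution.holomorphic_cauchy_inverse[OF \<nu> p(2)]
      real_distribution.holomorphic_cauchy_inverse[OF \<rho> p(3)]
    by (intro holomorphic_on_diff holomorphic_on_divide holomorphic_on_const holomorphic_on_ident nz;
        auto elim: holomorphic_on_subset)+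
  have z': "z \<in> ?L" using z by simp
  have sub: "?S \<subseteq> ?L" by blast
  show "R_transform \<rho> z = R_transform \<mu> z + R_transform \<nu> z"
    by (rule analytic_continuation_open[OF L(4,1,3,2) sub hol(3) holomorphic_on_add[OF hol(1,2)] _ z'])
      (rule eq, simp)
next
  fix \<rho>' assume "real_distribution \<rho>' \<and> (\<forall>z\<in>R_domain \<mu> \<inter> R_domain \<nu> \<inter> R_domain \<rho>'.
    R_transform \<rho>' z = R_transform \<mu> z + R_transform \<nu> z)"
  then have \<rho>': "real_distribution \<rho>'" and eq': "\<And>z. z \<in> R_domain \<mu> \<Longrightarrow> z \<in> R_domain \<nu> \<Longrightarrow> z \<in> R_domain \<rho>' \<Longrightarrow>
      R_transform \<rho>' z = R_transform \<mu> z + R_transform \<nu> z" by auto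
  obtain \<alpha>1 \<beta>1 \<delta>1 where p1: "inversion_params \<mu> \<gamma> \<alpha>1 \<beta>1 \<delta>1"
    using real_distribution.inversion_params_ex[OF \<mu> pos(1)] by blast
  obtain \<alpha>2 \<beta>2 \<delta>2 where p2: "inversion_params \<nu> \<gamma> \<alpha>2 \<beta>2 \<delta>2"
    using real_distribution.inversion_params_ex[OF \<nu> pos(1)] by blast
  obtain \<alpha>3 \<beta>3 \<delta>3 where p3: "inversion_params \<rho>' \<gamma> \<alpha>3 \<beta>3 \<delta>3"
    using real_distribution.inversion_params_ex[OF \<rho>' pos(1)] by blast
  \<comment> \<open>On this cone, which lies in all the domains concerned, \<rho>' and \<rho> have
    the same sum as R-transform.\<close>
  let ?d = "min \<delta> (min \<delta>1 (min \<delta>2 \<delta>3))"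
  show "\<rho>' = \<rho>"
  proof (rule R_transform_unique[OF \<rho>' \<rho> pos(1)])
    show "0 < ?d"
      using pos inversion_paramsD(4)[OF p1] inversion_paramsD(4)[OF p2] inversion_paramsD(4)[OF p3] by simp
    fix z assume "z \<in> lower_cone \<gamma> ?d"
    then have z: "z \<in> lower_cone \<gamma> \<delta>" "z \<in> lower_cone \<gamma> \<delta>1" "z \<in> lower_cone \<gamma> \<delta>2" "z \<in> lower_cone \<gamma> \<delta>3"
      by (simp_all add: mem_lower_cone_min)
    have "z \<in> R_domain \<mu>" "z \<in> R_domain \<nu>" "z \<in> R_domain \<rho>'"
      unfolding R_domain_def using p1 p2 p3 z by blast+
    from eq'[OF this] eq[OF z(1)] show "R_transform \<rho>' z = R_transform \<rho> z" by simp
  qed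
qed

theorem (in real_distribution) free_convolution_semicircle_eqI:
  assumes t: "0 < t" and \<rho>: "real_distribution \<rho>"
    and sub: "\<And>z. 0 < Im z \<Longrightarrow> subord t z = z - of_real t * cauchy_transform \<rho> z"
  shows "M \<boxplus> semicircle t = \<rho>"
proof -
  obtain d where d: "0 < d" "\<And>z. z \<in> lower_cone 1 d \<Longrightarrow> R_transform (semicircle t) z = of_real t * z"
    using R_transform_semicircle[OF t] by blast
  obtain d' where d': "0 < d'" "\<And>z. z \<in> lower_cone 1 d' \<Longrightarrow>
      R_transform \<rho> z = R_transform M z + of_real t * z"
    using R_transform_subord[OF t \<rho> sub] by blast
  show ?thesis
  proof (rule free_convolution_eqI[OF real_distribution_axioms real_distribution_semicircle[OF t] \<rho> zero_less_one])
    show "0 < min d d'" using d d' by simp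
    show "R_transform \<rho> z = R_transform M z + R_transform (semicircle t) z"
      if "z \<in> lower_cone 1 (min d d')" for z
      using that d(2)[of z] d'(2)[of z] by (simp add: mem_lower_cone_min)
  qed
qed

section \<open>Unimodality\<close>

lemma unimodal_borel_measurable:
  fixes f :: "real \<Rightarrow> real"
  assumes "mono_on {..<a} f" "antimono_on {a<..} f"
  shows "f \<in> borel_measurable borel"
proof -
  \<comment> \<open>Negating \<open>f\<close> to the right of \<open>a\<close> makes every piece
    increasing; the point \<open>a\<close> is a piece of its own because nothing relates
    \<open>f a\<close> to the neighbouring values.\<close>
  let ?g = "\<lambda>x. if a < x then - f x else f x"
  have [measurable]: "?g \<in> borel_measurable borel"
  proof (rule borel_measurable_piecewise_mono[of "{{..<a}, {a}, {a<..}}"])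
    show "mono_on c ?g" if "c \<in> {{..<a}, {a}, {a<..}}" for c
      using that assms by (auto simp: monotone_on_def)
  qed auto
  have "(\<lambda>x. if a < x then - ?g x else ?g x) \<in> borel_measurable borel" by measurable
  moreover have "(\<lambda>x. if a < x then - ?g x else ?g x) = f" by auto
  ultimately show ?thesis by simp
qed

section \<open>Symmetric unimodal laws and their resolvent energy\<close>

context real_distribution
begin

lemma emeasure_symmetric:
  assumes "symmetric_measure M" and [measurable]: "A \<in> sets borel"
  shows "emeasure M (uminus -` A) = emeasure M A"
proof -
  have "emeasure M A = emeasure (distr M borel uminus) A"
    using assms(1) by (simp add: symmetric_measure_def)
  also have "\<dots> = emeasure M (uminus -` A)"
    by (subst emeasure_distr) auto
  finally show ?thesis ..
qed

lemma integral_symmetric: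
  fixes h :: "real \<Rightarrow> 'b::{banach, second_countable_topology}"
  assumes "symmetric_measure M" and [measurable]: "h \<in> borel_measurable borel"
  shows "(\<integral>x. h (- x) \<partial>M) = (\<integral>x. h x \<partial>M)"
proof -
  have "(\<integral>x. h x \<partial>M) = (\<integral>x. h x \<partial>(distr M borel uminus))"
    using assms(1) by (simp add: symmetric_measure_def)
  also have "\<dots> = (\<integral>x. h (- x) \<partial>M)"
    by (subst integral_distr) auto
  finally show ?thesis ..
qed

text \<open>The mode \<open>a\<close> in the definition of unimodality need not be the centre of symmetry (think
  of a uniform distribution), so the density is only compared at almost all points.\<close>

lemma symmetric_unimodal_density:
  assumes sym: "symmetric_measure M" and uni: "unimodal M"
  obtains a f where "f \<in> borel_measurable borel" "\<And>x. 0 \<le> f x" "integrable lborel f"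
    "a \<noteq> 0 \<Longrightarrow> measure M {a} = 0"
    "\<And>h. integrable M h \<Longrightarrow> (\<integral>x. h x \<partial>M) = h a * measure M {a} + (\<integral>x. f x * h x \<partial>lborel)"
    "\<And>c. AE x in lborel. \<bar>x\<bar> < \<bar>c - x\<bar> \<longrightarrow> f (c - x) \<le> f x"
    "\<And>c. AE x in lborel. \<bar>c - x\<bar> < \<bar>x\<bar> \<longrightarrow> f x \<le> f (c - x)"
proof -
  obtain a f where f0: "\<And>x. 0 \<le> f x" and mono: "mono_on {..<a} f" "antimono_on {a<..} f"
    and em: "\<And>A. A \<in> sets borel \<Longrightarrow> emeasure M A =
           emeasure M {a} * indicator A a + (\<integral>\<^sup>+x\<in>A. ennreal (f x) \<partial>lborel)"
    using uni unfolding unimodal_def by blast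
  note f[measurable] = unimodal_borel_measurable[OF mono]
  let ?D = "density lborel (\<lambda>x. ennreal (f x))"
  have em': "emeasure M A = emeasure M {a} * indicator A a + emeasure ?D A" if "A \<in> sets borel" for A
    using em[OF that] that by (simp add: emeasure_density)
  have null: "emeasure ?D {x} = 0" for x
    by (subst emeasure_density) (auto intro!: nn_integral_null_set simp: nn_integral_0_iff_AE AE_lborel_singleton)
  \<comment> \<open>By symmetry an atom at \<open>a\<close> would reappear at \<open>- a\<close>,
    which for \<open>a \<noteq> 0\<close> carries only mass from the density.\<close>
  have atom: "emeasure M {a} = 0" if "a \<noteq> 0"
  proof -
    have "emeasure M {a} = emeasure M (uminus -` {a})" by (rule emeasure_symmetric[OF sym, symmetric]) simp
    also have "uminus -` {a} = {- a}" by auto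
    also have "emeasure M {- a} = 0" using that by (subst em') (auto simp: null)
    finally show ?thesis .
  qed
  have D_sym: "emeasure ?D (uminus -` A) = emeasure ?D A" if A: "A \<in> sets borel" for A
  proof -
    have A': "uminus -` A \<in> sets borel"
      using measurable_sets[of uminus borel borel A] A by simp
    have "emeasure M {a} * indicator (uminus -` A) a = emeasure M {a} * indicator A a"
      using atom by (cases "a = 0") (auto simp: indicator_def)
    then have "emeasure M {a} * indicator A a + emeasure ?D (uminus -` A) =
      emeasure M {a} * indicator A a + emeasure ?D A"
      using em'[OF A] em'[OF A'] emeasure_symmetric[OF sym A] by (simp only:)
    \<comment> \<open>The common atom term must be finite before it can be cancelled in the extended
      nonnegative reals.\<close>
    moreover have "emeasure M {a} * indicator A a \<noteq> \<top>"
      by (simp add: ennreal_mult_eq_top_iff indicator_def)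
    ultimately show ?thesis by (metis ennreal_add_left_cancel infinity_ennreal_def)
  qed
  have f_even: "AE x in lborel. f (- x) = f x"
  proof -
    have "density lborel (\<lambda>x. ennreal (f (- x))) = ?D"
    proof (rule measure_eqI)
      fix A assume "A \<in> sets (density lborel (\<lambda>x. ennreal (f (- x))))"
      then have A[measurable]: "A \<in> sets borel" by simp
      have "emeasure ?D (uminus -` A) = (\<integral>\<^sup>+x. ennreal (f x) * indicator A (- x) \<partial>lborel)"
        using measurable_sets[of uminus borel borel A] A
        by (subst emeasure_density) (auto simp: indicator_def intro!: nn_integral_cong)
      also have "\<dots> = (\<integral>\<^sup>+x. ennreal (f (- x)) * indicator A x \<partial>lborel)"
        by (subst nn_integral_real_affine[where c = "-1" and t = 0]) auto
      also have "\<dots> = emeasure (density lborel (\<lambda>x. ennreal (f (- x)))) A"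
        by (subst emeasure_density) auto
      finally show "emeasure (density lborel (\<lambda>x. ennreal (f (- x)))) A = emeasure ?D A"
        using D_sym[OF A] by simp
    qed simp
    then have "AE x in lborel. ennreal (f (- x)) = ennreal (f x)"
      by (subst (asm) sigma_finite_measure.density_unique_iff[OF lborel.sigma_finite_measure_axioms]) auto
    then show ?thesis by eventually_elim (simp add: f0)
  qed
  have good: "AE x in lborel. f (- x) = f x \<and> x \<noteq> a \<and> x \<noteq> - a"
    using f_even AE_lborel_singleton[of a] AE_lborel_singleton[of "- a"] by eventually_elim simp
  have good': "AE x in lborel. f (- (c - x)) = f (c - x) \<and> c - x \<noteq> a \<and> c - x \<noteq> - a" for c
    using AE_borel_affine[of "-1" "\<lambda>x. f (- x) = f x \<and> x \<noteq> a \<and> x \<noteq> - a" c] good by simp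
  \<comment> \<open>At good points \<open>f\<close> depends on the absolute value only. If
    \<open>\<bar>x\<bar>\<close> lies to the right of \<open>a\<close>, compare it with
    \<open>\<bar>y\<bar>\<close> on the decreasing side; otherwise
    \<open>- \<bar>y\<bar> < \<bar>x\<bar> < a\<close> and the increasing side applies. The position
    of \<open>a\<close> relative to 0 thus never has to be known.\<close>
  have le: "f y \<le> f x" if x: "f (- x) = f x" "x \<noteq> a" "x \<noteq> - a" and y: "f (- y) = f y" "y \<noteq> a" "y \<noteq> - a"
    and xy: "\<bar>x\<bar> < \<bar>y\<bar>" for x y
  proof -
    have fx: "f \<bar>x\<bar> = f x" "f (- \<bar>x\<bar>) = f x" and fy: "f \<bar>y\<bar> = f y" "f (- \<bar>y\<bar>) = f y"
      using x y by (auto simp: abs_if)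
    have "\<bar>x\<bar> \<noteq> a" using x by auto
    then have "a < \<bar>x\<bar> \<or> \<bar>x\<bar> < a" by linarith
    then show ?thesis
    proof
      assume "a < \<bar>x\<bar>"
      then have "f \<bar>y\<bar> \<le> f \<bar>x\<bar>" using mono(2) xy by (auto simp: monotone_on_def)
      then show ?thesis using fx fy by simp
    next
      assume "\<bar>x\<bar> < a"
      then have "f (- \<bar>y\<bar>) \<le> f \<bar>x\<bar>" using mono(1) xy by (auto simp: monotone_on_def)
      then show ?thesis using fx fy by simp
    qed
  qed
  \<comment> \<open>Restricting \<open>M\<close> to the complement of \<open>a\<close> leaves
    exactly the absolutely continuous part, so integrals against \<open>M\<close> split into an atom
    term and a Lebesgue integral.\<close>
  have D_restr: "density M (\<lambda>x. ennreal (indicator (- {a}) x)) = ?D"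
  proof (rule measure_eqI)
    fix A assume "A \<in> sets (density M (\<lambda>x. ennreal (indicator (- {a}) x)))"
    then have A[measurable]: "A \<in> sets borel" by simp
    have "emeasure (density M (\<lambda>x. ennreal (indicator (- {a}) x))) A
      = (\<integral>\<^sup>+x. ennreal (indicator (- {a}) x) * indicator A x \<partial>M)"
      by (subst emeasure_density) auto
    also have "\<dots> = (\<integral>\<^sup>+x. indicator (A - {a}) x \<partial>M)"
      by (intro nn_integral_cong) (auto split: split_indicator)
    also have "\<dots> = emeasure M (A - {a})" by simp
    also have "\<dots> = emeasure ?D (A - {a})" by (subst em') auto
    also have "\<dots> = emeasure ?D A" using null[of a] by (intro emeasure_Diff_null_set) auto
    finally show "emeasure (density M (\<lambda>x. ennreal (indicator (- {a}) x))) A = emeasure ?D A" .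
  qed simp
  have fint: "integrable lborel f"
  proof (rule integrableI_nonneg)
    have "(\<integral>\<^sup>+x. ennreal (f x) \<partial>lborel) = emeasure ?D UNIV" by (subst emeasure_density) auto
    also have "\<dots> \<le> emeasure M UNIV" using em'[of UNIV] by simp
    also have "\<dots> < \<infinity>" using emeasure_finite[of UNIV] by (metis infinity_ennreal_def less_top)
    finally show "(\<integral>\<^sup>+x. ennreal (f x) \<partial>lborel) < \<infinity>" .
  qed (use f0 in auto)
  show thesis
  proof (rule that[OF f f0 fint])
    show "measure M {a} = 0" if "a \<noteq> 0" using atom[OF that] by (simp add: measure_def)
    show "(\<integral>x. h x \<partial>M) = h a * measure M {a} + (\<integral>x. f x * h x \<partial>lborel)" if h: "integrable M h" for h
    proof -
      have [measurable]: "h \<in> borel_measurable borel" using borel_measurable_integrable[OF h] by simp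
      have "(\<integral>x. h x \<partial>M) = (\<integral>x. h a * indicator {a} x + indicator (- {a}) x * h x \<partial>M)"
        by (intro Bochner_Integration.integral_cong) (auto split: split_indicator)
      also have "\<dots> = (\<integral>x. h a * indicator {a} x \<partial>M) + (\<integral>x. indicator (- {a}) x * h x \<partial>M)"
      proof (rule Bochner_Integration.integral_add)
        show "integrable M (\<lambda>x. h a * indicator {a} x)"
          by (intro integrable_mult_right integrable_const_bound[where B = 1]) (auto simp: indicator_def)
        show "integrable M (\<lambda>x. indicator (- {a}) x * h x)"
          using integrable_real_mult_indicator[OF _ h, of "- {a}"] by (simp add: mult.commute)
      qed
      also have "(\<integral>x. indicator (- {a}) x * h x \<partial>M) = (\<integral>x. h x \<partial>?D)"
        unfolding D_restr[symmetric] by (subst integral_density) auto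
      also have "\<dots> = (\<integral>x. f x * h x \<partial>lborel)"
        using f0 by (subst integral_density) auto
      finally show ?thesis by simp
    qed
    show "AE x in lborel. \<bar>x\<bar> < \<bar>c - x\<bar> \<longrightarrow> f (c - x) \<le> f x" for c
      using good good'[of c] by eventually_elim (use le in blast)
    show "AE x in lborel. \<bar>c - x\<bar> < \<bar>x\<bar> \<longrightarrow> f x \<le> f (c - x)" for c
      using good good'[of c] by eventually_elim (use le in blast)
  qed
qed

text \<open>For \<open>0 \<le> u < u'\<close> the difference of the two kernels is odd about the midpoint of \<open>u\<close> and
  \<open>u'\<close>, while the density is at least as large to the left of the midpoint as at the mirror image.\<close>

lemma resolvent_energy_antimono_Re:
  assumes sym: "symmetric_measure M" and uni: "unimodal M" and v: "0 < v" and u: "0 \<le> u" "u < u'"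
  shows "resolvent_energy (Complex u' v) \<le> resolvent_energy (Complex u v)"
proof -
  obtain a f where f[measurable]: "f \<in> borel_measurable borel" and f0: "\<And>x. 0 \<le> f x" and fint: "integrable lborel f"
    and atom: "a \<noteq> 0 \<Longrightarrow> measure M {a} = 0"
    and int: "\<And>h. integrable M h \<Longrightarrow> (\<integral>x. h x \<partial>M) = h a * measure M {a} + (\<integral>x. f x * h x \<partial>lborel)"
    and le: "\<And>c. AE x in lborel. \<bar>x\<bar> < \<bar>c - x\<bar> \<longrightarrow> f (c - x) \<le> f x"
      "\<And>c. AE x in lborel. \<bar>c - x\<bar> < \<bar>x\<bar> \<longrightarrow> f x \<le> f (c - x)"
    by (rule symmetric_unimodal_density[OF sym uni]) (rule that)
  let ?K = "\<lambda>s x. 1 / ((s - x)\<^sup>2 + v\<^sup>2)"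
  define d where "d = (\<lambda>x. ?K u x - ?K u' x)"
  have K: "1 / (norm (Complex s v - of_real x))\<^sup>2 = ?K s x" for s x by (simp add: cmod_power2)
  have Kint: "integrable M (?K s)" for s
    using integrable_resolvent_norm[of "Complex s v"] v by (simp add: K)
  have Kpos: "0 < (s - x)\<^sup>2 + v\<^sup>2" for s x using v by (simp add: add_nonneg_pos)
  have dint: "integrable M d" unfolding d_def by (intro Bochner_Integration.integrable_diff Kint)
  have [measurable]: "d \<in> borel_measurable borel" unfolding d_def by measurable
  have d_nonneg: "0 \<le> d x" if "2 * x \<le> u + u'" for x
  proof -
    have "0 \<le> (u' - u) * (u + u' - 2 * x)" using that u by simp
    then have "(u - x)\<^sup>2 \<le> (u' - x)\<^sup>2" by (simp add: power2_eq_square algebra_simps)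
    then show ?thesis using Kpos[of u x] unfolding d_def by (simp add: frac_le)
  qed
  have d_odd: "d (u + u' - x) = - d x" for x
  proof -
    have "u - (u + u' - x) = - (u' - x)" "u' - (u + u' - x) = - (u - x)" by simp_all
    then show ?thesis unfolding d_def by (simp only: power2_minus)
  qed
  have fd: "integrable lborel (\<lambda>x. f x * d x)"
  proof (rule Bochner_Integration.integrable_bound)
    show "integrable lborel (\<lambda>x. 2 / v\<^sup>2 * f x)" using fint by (rule integrable_mult_right)
    have "?K s x \<le> 1 / v\<^sup>2" "0 \<le> ?K s x" for s x
      using v Kpos[of s x] by (auto intro!: divide_left_mono)
    then have "\<bar>d x\<bar> \<le> 2 / v\<^sup>2" for x
      unfolding d_def by (smt (verit) add_divide_distrib)
    then show "AE x in lborel. norm (f x * d x) \<le> norm (2 / v\<^sup>2 * f x)"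
      using f0 by (auto simp: abs_mult mult.commute[of "f _"] simp del: times_divide_eq_left intro!: mult_right_mono)
  qed measurable
  have fd': "integrable lborel (\<lambda>x. f (u + u' - x) * d x)"
    and fd'_eq: "(\<integral>x. f (u + u' - x) * d x \<partial>lborel) = - (\<integral>x. f x * d x \<partial>lborel)"
  proof -
    have eq: "f (u + u' + - 1 * x) * d (u + u' + - 1 * x) = - (f (u + u' - x) * d x)" for x
      using d_odd[of x] by simp
    show "integrable lborel (\<lambda>x. f (u + u' - x) * d x)"
      using lborel_integrable_real_affine[OF fd, of "-1" "u + u'"] unfolding eq by simp
    show "(\<integral>x. f (u + u' - x) * d x \<partial>lborel) = - (\<integral>x. f x * d x \<partial>lborel)"
      by (subst (2) lborel_integral_real_affine[of "-1" _ "u + u'"]) (auto simp only: eq, simp)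
  qed
  \<comment> \<open>Both \<open>f x - f (u + u' - x)\<close> and \<open>d x\<close> change sign at
    the midpoint, so their product is nonnegative; since \<open>d\<close> is odd about the midpoint,
    the integral is twice that of \<open>f x * d x\<close>.\<close>
  have "0 \<le> (\<integral>x. f x * d x - f (u + u' - x) * d x \<partial>lborel)"
  proof (rule integral_nonneg_AE)
    show "AE x in lborel. 0 \<le> f x * d x - f (u + u' - x) * d x"
      using le[of "u + u'"]
    proof eventually_elim
      case (elim x)
      show ?case
      proof (cases "2 * x" "u + u'" rule: linorder_cases)
        case less
        then have "\<bar>x\<bar> < \<bar>u + u' - x\<bar>" using u by linarith
        then have "0 \<le> (f x - f (u + u' - x)) * d x" using elim d_nonneg less by (intro mult_nonneg_nonneg) auto
        then show ?thesis by (simp add: algebra_simps)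
      next
        case equal
        then have "u + u' - x = x" by simp
        then show ?thesis by simp
      next
        case greater
        then have "\<bar>u + u' - x\<bar> < \<bar>x\<bar>" using u by linarith
        moreover have "d x \<le> 0" using d_nonneg[of "u + u' - x"] greater d_odd[of x] by simp
        ultimately have "0 \<le> (f x - f (u + u' - x)) * d x" using elim by (intro mult_nonpos_nonpos) auto
        then show ?thesis by (simp add: algebra_simps)
      qed
    qed
  qed
  also have "\<dots> = 2 * (\<integral>x. f x * d x \<partial>lborel)"
    by (subst Bochner_Integration.integral_diff[OF fd fd']) (simp add: fd'_eq)
  finally have "0 \<le> (\<integral>x. f x * d x \<partial>lborel)" by simp
  \<comment> \<open>A nonzero atom can only sit at 0, which is to the left of the midpoint, where
    \<open>d\<close> is nonnegative.\<close>
  moreover have "0 \<le> d a * measure M {a}"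
    using atom d_nonneg[of 0] u by (cases "a = 0") auto
  ultimately have "0 \<le> (\<integral>x. d x \<partial>M)" using int[OF dint] by simp
  also have "(\<integral>x. d x \<partial>M) = resolvent_energy (Complex u v) - resolvent_energy (Complex u' v)"
    unfolding d_def resolvent_energy_def K by (intro Bochner_Integration.integral_diff Kint)
  finally show ?thesis by simp
qed

section \<open>Reflection in the imaginary axis\<close>

lemma cauchy_transform_reflect:
  assumes sym: "symmetric_measure M"
  shows "cauchy_transform M (- cnj w) = - cnj (cauchy_transform M w)"
proof -
  have "cauchy_transform M (- cnj w) = (\<integral>x. 1 / (- cnj w - of_real (- x)) \<partial>M)"
    unfolding cauchy_transform_def by (intro integral_symmetric[OF sym, symmetric]) measurable
  also have "\<dots> = (\<integral>x. - cnj (1 / (w - of_real x)) \<partial>M)"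
    by (intro Bochner_Integration.integral_cong) (auto simp: minus_divide_right)
  also have "\<dots> = - cnj (cauchy_transform M w)"
    unfolding cauchy_transform_def by (subst integral_minus) (simp only: Bochner_Integration.integral_cnj)
  finally show ?thesis .
qed

lemma resolvent_energy_abs_Re:
  assumes sym: "symmetric_measure M"
  shows "0 < v \<Longrightarrow> resolvent_energy (Complex \<bar>u\<bar> v) = resolvent_energy (Complex u v)"
proof -
  assume v: "0 < v"
  have "- cnj (Complex u v) = Complex (- u) v" by (simp add: complex_eq_iff)
  then have "resolvent_energy (Complex (- u) v) = resolvent_energy (Complex u v)"
    using cauchy_transform_reflect[OF sym, of "Complex u v"] v Im_cauchy_transform[of "Complex u v"]
      Im_cauchy_transform[of "Complex (- u) v"] by auto
  then show ?thesis by (simp add: abs_if)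
qed

lemma resolvent_energy_antimono_abs_Re:
  assumes "symmetric_measure M" "unimodal M" "0 < v" "\<bar>u\<bar> \<le> \<bar>u'\<bar>"
  shows "resolvent_energy (Complex u' v) \<le> resolvent_energy (Complex u v)"
proof -
  have "resolvent_energy (Complex \<bar>u'\<bar> v) \<le> resolvent_energy (Complex \<bar>u\<bar> v)"
    using resolvent_energy_antimono_Re[OF assms(1-3), of "\<bar>u\<bar>" "\<bar>u'\<bar>"] assms(4)
    by (cases "\<bar>u\<bar> = \<bar>u'\<bar>") auto
  then show ?thesis by (simp only: resolvent_energy_abs_Re[OF assms(1,3)])
qed

text \<open>\<open>H\<close> commutes with the reflection \<open>w \<mapsto> - cnj w\<close>, and
  preimages under \<open>H\<close> in its domain are unique.\<close>

lemma subord_reflect: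
  assumes t: "0 < t" and sym: "symmetric_measure M" and z: "0 < Im z"
  shows "subord t (- cnj z) = - cnj (subord t z)"
proof (rule subord_eqI[OF t])
  show "0 < Im (- cnj z)" using z by simp
  show eq: "subord_map t (- cnj (subord t z)) = - cnj z"
  proof -
    have "subord_map t (- cnj w) = - cnj (subord_map t w)" for w
      by (simp add: subord_map_def cauchy_transform_reflect[OF sym])
    then show ?thesis by (simp only: subord_map_subord[OF t z])
  qed
  then show "- cnj (subord t z) \<in> subord_domain t"
    using z Im_subord_pos[OF t z] by (subst subord_domain_iff) auto
qed

text \<open>Both points satisfy \<open>v * (1 - t * J) = y\<close>. If the point with the larger
  \<open>\<bar>u\<bar>\<close> also had the larger \<open>v\<close>, its energy would be no larger,
  as \<open>J\<close> decreases in \<open>\<bar>u\<bar>\<close> and in \<open>v\<close>, and the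
  left side would be strictly larger.\<close>

lemma Im_subord_antimono:
  assumes t: "0 < t" and sym: "symmetric_measure M" and uni: "unimodal M" and y: "0 < y"
    and le: "\<bar>Re (subord t (Complex x y))\<bar> \<le> \<bar>Re (subord t (Complex x' y))\<bar>"
  shows "Im (subord t (Complex x' y)) \<le> Im (subord t (Complex x y))"
proof (rule ccontr)
  let ?w = "subord t (Complex x y)" and ?w' = "subord t (Complex x' y)"
  assume "\<not> Im ?w' \<le> Im ?w"
  then have lt: "Im ?w < Im ?w'" by simp
  have pos: "0 < Im ?w" "0 < Im ?w'" using y by (auto intro!: Im_subord_pos[OF t])
  have eq: "Im ?w * (1 - t * resolvent_energy ?w) = y" "Im ?w' * (1 - t * resolvent_energy ?w') = y"
    using Im_subord_map[OF pos(1), of t] Im_subord_map[OF pos(2), of t] y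
      subord_map_subord[OF t, of "Complex x y"] subord_map_subord[OF t, of "Complex x' y"] by auto
  have "resolvent_energy ?w' \<le> resolvent_energy (Complex (Re ?w) (Im ?w'))"
    using resolvent_energy_antimono_abs_Re[OF sym uni pos(2) le] by simp
  also have "\<dots> \<le> resolvent_energy ?w"
    using resolvent_energy_antimono[OF pos(1), of "Im ?w'" "Re ?w"] lt by simp
  finally have "1 - t * resolvent_energy ?w \<le> 1 - t * resolvent_energy ?w'" using t by simp
  moreover have "0 < 1 - t * resolvent_energy ?w"
    using subord_in_domain[OF t, of "Complex x y"] y by (simp add: subord_domain_def)
  ultimately have "Im ?w * (1 - t * resolvent_energy ?w) < Im ?w' * (1 - t * resolvent_energy ?w')"
    using lt pos by (intro mult_strict_right_mono[THEN less_le_trans] mult_left_mono) auto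
  then show False using eq by simp
qed

text \<open>Passes from comparing \<open>u\<close> to comparing \<open>x\<close>: by reflection
  symmetry \<open>u = 0\<close> at \<open>x = 0\<close>, and \<open>u\<close> increases with
  \<open>x\<close>, so \<open>\<bar>u\<bar>\<close> increases for \<open>x \<ge> 0\<close>.\<close>

lemma Im_subord_antimono_on:
  assumes t: "0 < t" and sym: "symmetric_measure M" and uni: "unimodal M" and y: "0 < y"
    and le: "0 \<le> x" "x \<le> x'"
  shows "Im (subord t (Complex x' y)) \<le> Im (subord t (Complex x y))"
proof (rule Im_subord_antimono[OF t sym uni y])
  have "- cnj (Complex 0 y) = Complex 0 y" by (simp add: complex_eq_iff)
  then have "Re (subord t (Complex 0 y)) = - Re (subord t (Complex 0 y))"
    using subord_reflect[OF t sym, of "Complex 0 y"] y by (metis cnj.sel(1) complex.sel(2) uminus_complex.sel(1))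
  then have "Re (subord t (Complex 0 y)) = 0" by simp
  then have "0 \<le> Re (subord t (Complex x y))" "Re (subord t (Complex x y)) \<le> Re (subord t (Complex x' y))"
    using Re_subord_strict_mono[OF t y, of 0 x] Re_subord_strict_mono[OF t y, of x x'] le
    by (auto simp: le_less)
  then show "\<bar>Re (subord t (Complex x y))\<bar> \<le> \<bar>Re (subord t (Complex x' y))\<bar>" by simp
qed

lemma Im_subord_abs:
  assumes t: "0 < t" and sym: "symmetric_measure M" and y: "0 < y"
  shows "Im (subord t (Complex \<bar>x\<bar> y)) = Im (subord t (Complex x y))"
proof -
  have "- cnj (Complex x y) = Complex (- x) y" by (simp add: complex_eq_iff)
  then have "Im (subord t (Complex (- x) y)) = Im (subord t (Complex x y))"
    using subord_reflect[OF t sym, of "Complex x y"] y by simp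
  then show ?thesis by (cases "x < 0") (simp_all only: abs_if if_True if_False)
qed

lemma Im_subord_le:
  assumes t: "0 < t" and z: "0 < Im z"
  shows "Im (subord t z) \<le> Im z + t * sqrt (1 / t)"
proof -
  have "Im (subord t z) = Im z - t * Im (cauchy_transform M (subord t z))"
    by (subst subord_eq[OF t z]) simp
  moreover have "- Im (cauchy_transform M (subord t z)) \<le> sqrt (1 / t)"
    using norm_cauchy_transform_subord_domain_le[OF t subord_in_domain[OF t z]]
      abs_Im_le_cmod[of "cauchy_transform M (subord t z)"] by linarith
  then have "t * - Im (cauchy_transform M (subord t z)) \<le> t * sqrt (1 / t)"
    using t by (intro mult_left_mono) auto
  ultimately show ?thesis by simp
qed

end

section \<open>The limiting density\<close>

lemma unimodal_density_abs:
  assumes q: "\<And>x. 0 \<le> q x" "antimono q"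
  shows "unimodal (density lborel (\<lambda>x. ennreal (q \<bar>x\<bar>)))"
proof -
  let ?f = "\<lambda>x. q \<bar>x\<bar>"
  have m: "mono_on {..<0} ?f" "antimono_on {0<..} ?f"
    using q(2) by (auto simp: monotone_on_def)
  note [measurable] = unimodal_borel_measurable[OF m]
  let ?D = "density lborel (\<lambda>x. ennreal (?f x))"
  have "emeasure ?D {0} = 0"
    by (subst emeasure_density) (auto simp: nn_integral_0_iff_AE AE_lborel_singleton)
  then show ?thesis
    unfolding unimodal_def using q(1) m
    by (intro conjI exI[of _ 0] exI[of _ ?f] ballI allI) (auto simp: emeasure_density)
qed

theorem theorem3p6:
  fixes \<mu> :: "real measure" and t :: real
  assumes "real_distribution \<mu>"
    and "symmetric_measure \<mu>"
    and "unimodal \<mu>"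
    and "t > 0"
  shows "unimodal (\<mu> \<boxplus> semicircle t)"
proof -
  interpret real_distribution \<mu> by (rule assms)
  note sym = assms(2) and uni = assms(3) and t = assms(4)
  define \<epsilon> where "\<epsilon> n = 1 / real (Suc n)" for n
  have \<epsilon>_pos: "0 < \<epsilon> n" "\<epsilon> n \<le> 1" for n by (simp_all add: \<epsilon>_def)
  have \<epsilon>0: "\<epsilon> \<longlonglongrightarrow> 0"
    using LIMSEQ_Suc[OF lim_const_over_n[of "1::real"]] by (simp add: \<epsilon>_def[abs_def])
  \<comment> \<open>Helly selection is stated for increasing functions on the whole line. Hence the
    minus sign, and the clamp at 0, since \<open>Im F\<close> decreases only on the right half-line;
    the left half is restored by symmetry.\<close>
  define g where "g = (\<lambda>n x. - Im (subord t (Complex (max x 0) (\<epsilon> n))))"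
  have cont: "continuous (at_right x) (g n)" for n x
  proof -
    have "continuous_on UNIV (\<lambda>x. subord t (of_real (max x 0) + \<i> * of_real (\<epsilon> n)))"
      by (rule continuous_on_compose2[OF continuous_on_subord[OF t]]) (auto intro!: continuous_intros simp: \<epsilon>_pos)
    from continuous_on_minus[OF continuous_on_Im[OF this]] have "continuous_on UNIV (g n)"
      unfolding g_def Complex_eq .
    then have "isCont (g n) x" by (simp add: continuous_on_eq_continuous_at)
    then show ?thesis by (rule continuous_at_imp_continuous_at_within)
  qed
  have mono: "mono (g n)" for n
    unfolding g_def by (auto intro!: monoI Im_subord_antimono_on[OF t sym uni \<epsilon>_pos(1)])
  have bdd: "\<bar>g n x\<bar> \<le> 1 + t * sqrt (1 / t)" for n x
    using Im_subord_le[OF t, of "Complex (max x 0) (\<epsilon> n)"] Im_subord_pos[OF t, of "Complex (max x 0) (\<epsilon> n)"]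
      \<epsilon>_pos[of n] unfolding g_def by simp
  obtain s \<Phi> where s: "strict_mono s" and \<Phi>: "mono \<Phi>"
    and lim: "\<And>x. isCont \<Phi> x \<Longrightarrow> (\<lambda>n. g (s n) x) \<longlonglongrightarrow> \<Phi> x"
    using Helly_selection[where f = g, OF cont mono bdd] by blast
  \<comment> \<open>The limit \<Phi> is seen to be nonpositive only where it is continuous; the
    maximum with 0 secures \<open>q \<ge> 0\<close> at the remaining points without spoiling
    monotonicity.\<close>
  define q where "q x = max 0 (- \<Phi> x) / (pi * t)" for x
  have q0: "0 \<le> q x" for x using t by (simp add: q_def)
  have q_antimono: "antimono q"
  proof (rule antimonoI)
    fix x y :: real assume "x \<le> y"
    then have "\<Phi> x \<le> \<Phi> y" by (rule monoD[OF \<Phi>])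
    then show "q y \<le> q x" unfolding q_def using t by (intro divide_right_mono) auto
  qed
  let ?p = "\<lambda>x. q \<bar>x\<bar>"
  have "mono_on {..<0} ?p" "antimono_on {0<..} ?p"
    using q_antimono by (auto simp: monotone_on_def)
  then have p: "?p \<in> borel_measurable borel" by (rule unimodal_borel_measurable)
  have "AE x in lborel. (\<lambda>n. Im (subord t (Complex x (\<epsilon> (s n))))) \<longlonglongrightarrow> pi * t * ?p x"
  proof -
    \<comment> \<open>Convergence is needed at \<open>\<bar>x\<bar>\<close>, so the discontinuities
      and their mirror images are both discarded.\<close>
    let ?B = "{x. \<not> isCont \<Phi> x}"
    have "countable (?B \<union> uminus ` ?B)"
      using mono_ctble_discont[OF \<Phi>] by simp
    then have "AE x in lborel. x \<notin> ?B \<union> uminus ` ?B"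
      by (intro AE_not_in countable_imp_null_set_lborel)
    then show ?thesis
    proof eventually_elim
      case (elim x)
      then have "isCont \<Phi> \<bar>x\<bar>"
        by (auto simp: abs_if image_iff)
      from lim[OF this] have l: "(\<lambda>n. g (s n) \<bar>x\<bar>) \<longlonglongrightarrow> \<Phi> \<bar>x\<bar>" .
      have g: "g (s n) \<bar>x\<bar> = - Im (subord t (Complex x (\<epsilon> (s n))))" for n
        unfolding g_def using Im_subord_abs[OF t sym \<epsilon>_pos(1), of x "s n"] by simp
      have "g (s n) \<bar>x\<bar> \<le> 0" for n
        unfolding g using Im_subord_pos[OF t, of "Complex x (\<epsilon> (s n))"] \<epsilon>_pos(1)[of "s n"] by simp
      then have "\<Phi> \<bar>x\<bar> \<le> 0" using l by (intro LIMSEQ_le_const2[OF l]) auto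
      then have "pi * t * ?p x = - \<Phi> \<bar>x\<bar>" using t by (simp add: q_def)
      with tendsto_minus[OF l] show ?case unfolding g by simp
    qed
  qed
  note * = subord_density[OF t \<epsilon>_pos(1) LIMSEQ_subseq_LIMSEQ[OF \<epsilon>0 s, unfolded o_def] p q0 this]
  have "\<mu> \<boxplus> semicircle t = density lborel ?p"
    by (rule free_convolution_semicircle_eqI[OF t *])
  then show ?thesis using unimodal_density_abs[OF q0 q_antimono] by simp
qed

end
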